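(* There is a function $\varepsilon(n)\to 0$ as $n\to\infty$ such that for every $n$, every graph $G$ on $n$ vertices and every family of nonnegative interaction strengths $J$, the mixing time $t_{\mathrm{mix}}^+(G,J)$ of the discrete-time Glauber dynamics for the Ising model on $G$ with interactions $J$, started from the all-plus configuration, satisfies $$t_{\mathrm{mix}}^+(G,J)\ \ge\ \Big(\tfrac14-\varepsilon(n)\Big)\, n\log n .$$ Equivalently, $\inf_{G,J} t_{\mathrm{mix}}^+(G,J)\ge (1/4+o(1))\,n\log n$, the infimum over all $n$-vertex graphs $G$ and all nonnegative interaction matrices $J$.
   Context: Let $G=(V,E)$ be a finite graph with $|V|=n$ and $J=\{J_{uv}\ge 0: uv\in E\}$. The (ferromagnetic, zero-field) Ising model is the probability measure on $\Omega=\{\pm1\}^V$ given by $\mu_G(\sigma)=Z(J)^{-1}\exp\big(\sum_{uv\in E}J_{uv}\sigma(u)\sigma(v)\big)$, where $Z(J)$ is a normalizing constant. The discrete-time Glauber dynamics is the Markov chain on $\Omega$ which at each step chooses a vertex $v\in V$ uniformly at random and replaces $\sigma(v)$ by a spin drawn from the conditional distribution under $\mu_G$ given the spins at all other vertices. For a chain with stationary distribution $\pi$, the total variation distance is $\|\mu-\nu\|_{TV}=\frac12\sum_x|\mu(x)-\nu(x)|$, and the mixing time from state $x$ is $t_{\mathrm{mix}}^x=\min\{t:\|\mathbb P_x(X_t\in\cdot)-\pi\|_{TV}\le 1/4\}$. $t_{\mathrm{mix}}^+$ denotes $t_{\mathrm{mix}}^x$ for $x$ the all-plus configuration. *)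

theory Defs
  imports Complex_Main "HOL-Library.FuncSet"
begin

(* Vertex set V = {0..<n}. A (simple) graph on V is given by its edge set E,
   a set of 2-element subsets of V. Interaction strengths J : E -> [0,inf). *)
definition is_graph :: "nat \<Rightarrow> nat set set \<Rightarrow> bool" where
  "is_graph n E \<longleftrightarrow> (\<forall>e\<in>E. \<exists>u v. u < n \<and> v < n \<and> u \<noteq> v \<and> e = {u, v})"

definition spins :: "nat \<Rightarrow> (nat \<Rightarrow> int) set" where
  "spins n = {..<n} \<rightarrow>\<^sub>E {-1, 1}"

definition all_plus :: "nat \<Rightarrow> nat \<Rightarrow> int" where
  "all_plus n = (\<lambda>v. if v < n then 1 else undefined)"

definition ising_H :: "nat set set \<Rightarrow> (nat set \<Rightarrow> real) \<Rightarrow> (nat \<Rightarrow> int) \<Rightarrow> real" where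
  "ising_H E J \<sigma> = (\<Sum>e\<in>E. J e * (\<Prod>v\<in>e. real_of_int (\<sigma> v)))"

definition ising_Z :: "nat \<Rightarrow> nat set set \<Rightarrow> (nat set \<Rightarrow> real) \<Rightarrow> real" where
  "ising_Z n E J = (\<Sum>\<sigma>\<in>spins n. exp (ising_H E J \<sigma>))"

definition ising_mu :: "nat \<Rightarrow> nat set set \<Rightarrow> (nat set \<Rightarrow> real) \<Rightarrow> (nat \<Rightarrow> int) \<Rightarrow> real" where
  "ising_mu n E J \<sigma> = exp (ising_H E J \<sigma>) / ising_Z n E J"

(* Discrete-time Glauber (heat-bath) dynamics: pick v uniformly from V and resample
   sigma(v) from the conditional law of mu given the spins off v. *)
definition glauber_P :: "nat \<Rightarrow> nat set set \<Rightarrow> (nat set \<Rightarrow> real) \<Rightarrow> (nat \<Rightarrow> int) \<Rightarrow> (nat \<Rightarrow> int) \<Rightarrow> real" where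
  "glauber_P n E J \<sigma> \<tau> =
     (1 / real n) * (\<Sum>v<n. if \<tau> = \<sigma>(v := \<tau> v)
        then ising_mu n E J \<tau> / (ising_mu n E J (\<sigma>(v := 1)) + ising_mu n E J (\<sigma>(v := -1)))
        else 0)"

fun glauber_dist :: "nat \<Rightarrow> nat set set \<Rightarrow> (nat set \<Rightarrow> real) \<Rightarrow> (nat \<Rightarrow> int) \<Rightarrow> nat \<Rightarrow> (nat \<Rightarrow> int) \<Rightarrow> real" where
  "glauber_dist n E J x 0 = (\<lambda>y. if y = x then 1 else 0)"
| "glauber_dist n E J x (Suc t) =
     (\<lambda>y. \<Sum>z\<in>spins n. glauber_dist n E J x t z * glauber_P n E J z y)"

definition tv_dist :: "'a set \<Rightarrow> ('a \<Rightarrow> real) \<Rightarrow> ('a \<Rightarrow> real) \<Rightarrow> real" where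
  "tv_dist \<Omega> \<mu> \<nu> = (1/2) * (\<Sum>x\<in>\<Omega>. \<bar>\<mu> x - \<nu> x\<bar>)"

definition tmix_from :: "nat \<Rightarrow> nat set set \<Rightarrow> (nat set \<Rightarrow> real) \<Rightarrow> (nat \<Rightarrow> int) \<Rightarrow> nat" where
  "tmix_from n E J x =
     (LEAST t. tv_dist (spins n) (glauber_dist n E J x t) (ising_mu n E J) \<le> 1/4)"

definition tmix_plus :: "nat \<Rightarrow> nat set set \<Rightarrow> (nat set \<Rightarrow> real) \<Rightarrow> nat" where
  "tmix_plus n E J = tmix_from n E J (all_plus n)"

end

theory Submission
  imports Defs "HOL-Real_Asymp.Real_Asymp"
begin

text \<open>
  Let \<open>M\<close> be the magnetization, \<open>V\<close> its second moment under the Ising measure, and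
  \<open>t < (1/4 - \<epsilon>) n ln n\<close>.

  If \<open>V\<close> is at most of order \<open>n powr (3/2) * ln n\<close>, look at the set \<open>U\<close> of vertices not selected up
  to time \<open>t\<close>, which by a second-moment count has size of order at least \<open>n powr (3/4) * sqrt (ln n)\<close>.
  By monotonicity, the chain started from all-plus dominates the configuration that is plus on \<open>U\<close> and
  is drawn off \<open>U\<close> from the Ising model with free boundary.  The latter is symmetric and, by Griffiths'
  second inequality, its magnetization has second moment at most \<open>V\<close>; so Chebyshev's inequality
  separates the law of \<open>M\<close> at time \<open>t\<close> from its stationary law.

  If \<open>V\<close> is larger, then the stationary chain hardly moves: the transition operator is an average of
  orthogonal projections, hence positive semidefinite, which makes the autocorrelations of \<open>M\<close> convex
  and bounds the mean square displacement of \<open>M\<close> by \<open>4 t\<close>.  Comparing the all-plus start with a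
  stationary start of magnetization at least \<open>sqrt (V/2)\<close>, the chain from all-plus still has \<open>M > 0\<close>
  with probability close to 1, whereas the stationary probability of this is at most 1/2.

  The mixing time is a \<open>LEAST\<close>, so the argument also needs that the chain does converge; this follows
  from a Doeblin minorization after \<open>n\<close> steps.
\<close>

section \<open>Spin configurations\<close>

lemma finite_spins [simp]: "finite (spins n)"
  unfolding spins_def by (rule finite_PiE) auto

lemma spins_cases:
  assumes "\<sigma> \<in> spins n" "v < n"
  shows "\<sigma> v = 1 \<or> \<sigma> v = -1"
  using assms unfolding spins_def by (auto simp: PiE_def Pi_def)

lemma spins_upd [simp]:
  assumes "\<sigma> \<in> spins n" "v < n" "s = 1 \<or> s = -1"
  shows "\<sigma>(v := s) \<in> spins n"
  using assms unfolding spins_def by (auto simp: PiE_def Pi_def extensional_def)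

lemma spins_flip:
  assumes "\<sigma> \<in> spins n" "v < n"
  shows "\<sigma>(v := - \<sigma> v) \<in> spins n"
  using spins_cases[OF assms] assms by auto

lemma all_plus_in_spins [simp]: "all_plus n \<in> spins n"
  unfolding spins_def all_plus_def by (auto simp: PiE_def Pi_def extensional_def)

lemma le_all_plus:
  assumes "\<sigma> \<in> spins n"
  shows "\<sigma> \<le> all_plus n"
  using assms unfolding spins_def all_plus_def le_fun_def
  by (auto simp: PiE_def Pi_def extensional_def)

lemma spins_extensional:
  assumes "\<sigma> \<in> spins n" "\<not> v < n"
  shows "\<sigma> v = undefined"
  using assms unfolding spins_def by (auto simp: PiE_def extensional_def)

text \<open>Flipping the spin at \<open>v\<close> is a bijection of \<open>spins n\<close>;
  averaging over it sums out one spin without introducing configurations on the remaining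
  vertices.\<close>

lemma sum_spins_site:
  fixes F :: "(nat \<Rightarrow> int) \<Rightarrow> real"
  assumes v: "v < n"
  shows "2 * (\<Sum>\<sigma>\<in>spins n. F \<sigma>) = (\<Sum>\<sigma>\<in>spins n. F (\<sigma>(v := 1)) + F (\<sigma>(v := -1)))"
proof -
  have "(\<Sum>\<sigma>\<in>spins n. F \<sigma>) = (\<Sum>\<sigma>\<in>spins n. F (\<sigma>(v := - \<sigma> v)))"
    by (rule sum.reindex_bij_witness[where i = "\<lambda>\<sigma>. \<sigma>(v := - \<sigma> v)" and j = "\<lambda>\<sigma>. \<sigma>(v := - \<sigma> v)"])
      (use v in \<open>auto intro: spins_flip\<close>)
  then have "2 * (\<Sum>\<sigma>\<in>spins n. F \<sigma>) = (\<Sum>\<sigma>\<in>spins n. F \<sigma> + F (\<sigma>(v := - \<sigma> v)))"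
    by (simp add: sum.distrib)
  also have "\<dots> = (\<Sum>\<sigma>\<in>spins n. F (\<sigma>(v := 1)) + F (\<sigma>(v := -1)))"
  proof (rule sum.cong[OF refl])
    fix \<sigma> assume "\<sigma> \<in> spins n"
    from spins_cases[OF this v] show "F \<sigma> + F (\<sigma>(v := - \<sigma> v)) = F (\<sigma>(v := 1)) + F (\<sigma>(v := -1))"
      by (auto simp: fun_upd_idem)
  qed
  finally show ?thesis .
qed

lemma ising_Z_pos: "ising_Z n E J > 0"
  unfolding ising_Z_def
  by (rule sum_pos) (auto intro!: all_plus_in_spins)

lemma ising_mu_pos: "ising_mu n E J \<sigma> > 0"
  unfolding ising_mu_def using ising_Z_pos by simp

lemma ising_mu_nonneg: "ising_mu n E J \<sigma> \<ge> 0"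
  using ising_mu_pos less_imp_le by blast

lemma sum_ising_mu: "(\<Sum>\<sigma>\<in>spins n. ising_mu n E J \<sigma>) = 1"
  using ising_Z_pos[of n E J]
  unfolding ising_mu_def by (simp add: ising_Z_def flip: sum_divide_distrib)

definition ising_E :: "nat \<Rightarrow> nat set set \<Rightarrow> (nat set \<Rightarrow> real) \<Rightarrow> ((nat \<Rightarrow> int) \<Rightarrow> real) \<Rightarrow> real" where
  "ising_E n E J f = (\<Sum>\<sigma>\<in>spins n. ising_mu n E J \<sigma> * f \<sigma>)"

lemma ising_E_mono:
  assumes "\<And>\<sigma>. \<sigma> \<in> spins n \<Longrightarrow> f \<sigma> \<le> g \<sigma>"
  shows "ising_E n E J f \<le> ising_E n E J g"
  unfolding ising_E_def
  by (intro sum_mono mult_left_mono assms ising_mu_nonneg)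

lemma ising_E_cong:
  assumes "\<And>\<sigma>. \<sigma> \<in> spins n \<Longrightarrow> f \<sigma> = g \<sigma>"
  shows "ising_E n E J f = ising_E n E J g"
  unfolding ising_E_def using assms by (auto intro: sum.cong)

lemma ising_E_const [simp]: "ising_E n E J (\<lambda>_. c) = c"
  unfolding ising_E_def by (simp add: sum_ising_mu flip: sum_distrib_right)

lemma ising_E_add: "ising_E n E J (\<lambda>\<sigma>. f \<sigma> + g \<sigma>) = ising_E n E J f + ising_E n E J g"
  unfolding ising_E_def by (simp add: algebra_simps sum.distrib)

lemma ising_E_diff: "ising_E n E J (\<lambda>\<sigma>. f \<sigma> - g \<sigma>) = ising_E n E J f - ising_E n E J g"
  unfolding ising_E_def by (simp add: algebra_simps sum_subtractf)

lemma ising_E_cmult: "ising_E n E J (\<lambda>\<sigma>. c * f \<sigma>) = c * ising_E n E J f"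
  unfolding ising_E_def by (simp add: algebra_simps sum_distrib_left)

lemma ising_E_sum: "ising_E n E J (\<lambda>\<sigma>. \<Sum>i\<in>I. f i \<sigma>) = (\<Sum>i\<in>I. ising_E n E J (f i))"
  unfolding ising_E_def by (subst sum.swap) (simp add: sum_distrib_left)

section \<open>Heat-bath operators\<close>

text \<open>The conditional expectation of \<open>f\<close> given the spins off \<open>v\<close>,
  under the measure proportional to \<open>W\<close>. The weight stays a parameter so that models
  with different couplings can be compared.\<close>

definition heat_bath ::
    "((nat \<Rightarrow> int) \<Rightarrow> real) \<Rightarrow> nat \<Rightarrow> ((nat \<Rightarrow> int) \<Rightarrow> real) \<Rightarrow> (nat \<Rightarrow> int) \<Rightarrow> real" where
  "heat_bath W v f \<sigma> =
     (W (\<sigma>(v := 1)) * f (\<sigma>(v := 1)) + W (\<sigma>(v := -1)) * f (\<sigma>(v := -1))) /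
     (W (\<sigma>(v := 1)) + W (\<sigma>(v := -1)))"

definition glauber_op ::
    "nat \<Rightarrow> ((nat \<Rightarrow> int) \<Rightarrow> real) \<Rightarrow> ((nat \<Rightarrow> int) \<Rightarrow> real) \<Rightarrow> (nat \<Rightarrow> int) \<Rightarrow> real" where
  "glauber_op n W f \<sigma> = (\<Sum>v<n. heat_bath W v f \<sigma>) / real n"

lemma sum_glauber_P:
  assumes \<sigma>: "\<sigma> \<in> spins n"
  shows "(\<Sum>\<tau>\<in>spins n. glauber_P n E J \<sigma> \<tau> * f \<tau>) = glauber_op n (ising_mu n E J) f \<sigma>"
proof -
  let ?W = "ising_mu n E J"
  have "(\<Sum>\<tau>\<in>spins n. (if \<tau> = \<sigma>(v := \<tau> v) then ?W \<tau> / (?W (\<sigma>(v := 1)) + ?W (\<sigma>(v := -1))) else 0) * f \<tau>)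
      = heat_bath ?W v f \<sigma>" (is "?L = _") if v: "v < n" for v
  proof -
    let ?g = "\<lambda>\<tau>. ?W \<tau> / (?W (\<sigma>(v := 1)) + ?W (\<sigma>(v := -1))) * f \<tau>"
    have set: "{\<tau>\<in>spins n. \<tau> = \<sigma>(v := \<tau> v)} = {\<sigma>(v := 1), \<sigma>(v := -1)}" (is "?A = ?B")
    proof (intro equalityI subsetI)
      fix \<tau> assume "\<tau> \<in> ?A"
      then show "\<tau> \<in> ?B" using spins_cases[of \<tau> n v] v by (auto dest: sym)
    next
      fix \<tau> assume "\<tau> \<in> ?B"
      then show "\<tau> \<in> ?A" using \<sigma> v by auto
    qed
    have ne: "\<sigma>(v := 1) \<noteq> \<sigma>(v := -1)"
      by (metis fun_upd_same one_neq_neg_one)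
    have "?L = (\<Sum>\<tau>\<in>spins n. if \<tau> = \<sigma>(v := \<tau> v) then ?g \<tau> else 0)"
      by (rule sum.cong[OF refl]) (simp only: if_distrib[of "\<lambda>c. c * f _"] mult_zero_left)
    also have "\<dots> = (\<Sum>\<tau>\<in>{\<tau>\<in>spins n. \<tau> = \<sigma>(v := \<tau> v)}. ?g \<tau>)"
      by (rule sum.inter_filter[symmetric]) simp
    also have "\<dots> = ?g (\<sigma>(v := 1)) + ?g (\<sigma>(v := -1))"
      unfolding set using ne by simp
    finally show ?thesis unfolding heat_bath_def by (simp add: add_divide_distrib)
  qed
  note hb = this
  have "(\<Sum>\<tau>\<in>spins n. glauber_P n E J \<sigma> \<tau> * f \<tau>)
     = (\<Sum>v<n. \<Sum>\<tau>\<in>spins n. (if \<tau> = \<sigma>(v := \<tau> v) then ?W \<tau> / (?W (\<sigma>(v := 1)) + ?W (\<sigma>(v := -1))) else 0) * f \<tau>) / real n"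
    unfolding glauber_P_def
    by (subst sum.swap) (simp add: sum_divide_distrib sum_distrib_right)
  also have "\<dots> = glauber_op n ?W f \<sigma>"
    unfolding glauber_op_def using hb by simp
  finally show ?thesis .
qed

text \<open>Duality: instead of pushing the law forward, the observable is pulled back. The last
  step of the chain is absorbed into \<open>f\<close>, so the induction runs over all
  \<open>f\<close>.\<close>

lemma glauber_dist_eq_op:
  assumes "x \<in> spins n"
  shows "(\<Sum>y\<in>spins n. glauber_dist n E J x t y * f y) = (glauber_op n (ising_mu n E J) ^^ t) f x"
proof (induction t arbitrary: f)
  case 0
  have "(\<Sum>y\<in>spins n. glauber_dist n E J x 0 y * f y) = (\<Sum>y\<in>spins n. if y = x then f y else 0)"
    by (rule sum.cong) auto
  then show ?case using assms by simp
next
  case (Suc t)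
  let ?d = "glauber_dist n E J x t" and ?P = "glauber_op n (ising_mu n E J)"
  have "(\<Sum>y\<in>spins n. glauber_dist n E J x (Suc t) y * f y)
      = (\<Sum>z\<in>spins n. \<Sum>y\<in>spins n. ?d z * (glauber_P n E J z y * f y))"
    by (subst sum.swap) (simp add: sum_distrib_right mult.assoc)
  also have "\<dots> = (\<Sum>z\<in>spins n. ?d z * ?P f z)"
    by (simp add: sum_glauber_P flip: sum_distrib_left)
  also have "\<dots> = (?P ^^ t) (?P f) x" by (rule Suc.IH)
  finally show ?case by (simp add: funpow_swap1)
qed

lemma glauber_P_nonneg: "glauber_P n E J \<sigma> \<tau> \<ge> 0"
  unfolding glauber_P_def
  by (intro mult_nonneg_nonneg sum_nonneg) (auto intro!: divide_nonneg_nonneg add_nonneg_nonneg ising_mu_nonneg)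

lemma glauber_dist_nonneg: "glauber_dist n E J x t y \<ge> 0"
  by (induction t arbitrary: y) (auto intro!: sum_nonneg mult_nonneg_nonneg glauber_P_nonneg)

lemma heat_bath_const:
  assumes "\<And>\<sigma>. W \<sigma> > 0"
  shows "heat_bath W v (\<lambda>_. c) \<sigma> = c"
proof -
  have "W (\<sigma>(v := 1)) + W (\<sigma>(v := -1)) > 0" by (intro add_pos_pos assms)
  then show ?thesis unfolding heat_bath_def by (simp add: field_simps)
qed

lemma glauber_op_const:
  assumes "\<And>\<sigma>. W \<sigma> > 0" "n > 0"
  shows "glauber_op n W (\<lambda>_. c) = (\<lambda>_. c)"
  unfolding glauber_op_def using assms by (simp add: heat_bath_const)

lemma funpow_glauber_op_const:
  assumes "\<And>\<sigma>. W \<sigma> > 0" "n > 0"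
  shows "(glauber_op n W ^^ t) (\<lambda>_. c) = (\<lambda>_. c)"
  by (induction t) (use assms in \<open>auto simp: glauber_op_const\<close>)

lemma sum_glauber_dist:
  assumes "x \<in> spins n" "n > 0"
  shows "(\<Sum>y\<in>spins n. glauber_dist n E J x t y) = 1"
  using glauber_dist_eq_op[OF assms(1), of E J t "\<lambda>_. 1"] assms(2)
  by (simp add: funpow_glauber_op_const ising_mu_pos)

lemma heat_bath_sum: "heat_bath W v (\<lambda>\<sigma>. \<Sum>i\<in>I. f i \<sigma>) \<sigma> = (\<Sum>i\<in>I. heat_bath W v (f i) \<sigma>)"
  unfolding heat_bath_def by (simp add: sum_distrib_left sum.distrib flip: sum_divide_distrib)

lemma heat_bath_cmult: "heat_bath W v (\<lambda>\<sigma>. c * f \<sigma>) \<sigma> = c * heat_bath W v f \<sigma>"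
  unfolding heat_bath_def by (simp add: algebra_simps)

lemma heat_bath_diff: "heat_bath W v (\<lambda>\<sigma>. f \<sigma> - g \<sigma>) \<sigma> = heat_bath W v f \<sigma> - heat_bath W v g \<sigma>"
  unfolding heat_bath_def by (simp add: algebra_simps diff_divide_distrib add_divide_distrib)

lemma glauber_op_diff: "glauber_op n W (\<lambda>\<sigma>. f \<sigma> - g \<sigma>) \<sigma> = glauber_op n W f \<sigma> - glauber_op n W g \<sigma>"
  unfolding glauber_op_def by (simp add: heat_bath_diff sum_subtractf diff_divide_distrib)

text \<open>Conditioning on the sequence \<open>w\<close> of selected vertices, all
  \<open>n ^ t\<close> of them equally likely. The head of \<open>w\<close> is the first vertex
  updated, since the outermost operator acts on the starting state.\<close>

lemma glauber_op_funpow_path: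
  "(glauber_op n W ^^ t) f \<sigma> =
     (\<Sum>w\<in>{w. set w \<subseteq> {..<n} \<and> length w = t}. foldr (heat_bath W) w f \<sigma>) / real n ^ t"
proof (induction t arbitrary: \<sigma>)
  case 0
  have "{w :: nat list. set w \<subseteq> {..<n} \<and> length w = 0} = {[]}" by auto
  then show ?case by simp
next
  case (Suc t)
  let ?L = "{w. set w \<subseteq> {..<n} \<and> length w = t}"
  have IH: "(glauber_op n W ^^ t) f = (\<lambda>\<sigma>. 1 / real n ^ t * (\<Sum>w\<in>?L. foldr (heat_bath W) w f \<sigma>))"
    using Suc.IH by auto
  have "(glauber_op n W ^^ Suc t) f \<sigma>
      = (\<Sum>v<n. 1 / real n ^ t * (\<Sum>w\<in>?L. heat_bath W v (foldr (heat_bath W) w f) \<sigma>)) / real n"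
    unfolding funpow.simps o_apply IH glauber_op_def[of n W _ \<sigma>] heat_bath_cmult heat_bath_sum ..
  also have "\<dots> = (\<Sum>v<n. \<Sum>w\<in>?L. heat_bath W v (foldr (heat_bath W) w f) \<sigma>) / real n ^ Suc t"
    unfolding sum_distrib_left[symmetric] by simp
  also have "(\<Sum>v<n. \<Sum>w\<in>?L. heat_bath W v (foldr (heat_bath W) w f) \<sigma>)
      = (\<Sum>(w, v)\<in>?L \<times> {..<n}. foldr (heat_bath W) (v # w) f \<sigma>)"
    by (subst sum.swap) (simp add: sum.cartesian_product)
  also have "\<dots> = (\<Sum>w\<in>{w. set w \<subseteq> {..<n} \<and> length w = Suc t}. foldr (heat_bath W) w f \<sigma>)"
    unfolding lists_length_Suc_eq
    by (subst sum.reindex) (auto simp: inj_on_def case_prod_unfold intro!: sum.cong)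
  finally show ?case .
qed

section \<open>Reversibility\<close>

lemma heat_bath_upd [simp]: "heat_bath W v f (\<sigma>(v := s)) = heat_bath W v f \<sigma>"
  unfolding heat_bath_def by simp

text \<open>The spin at \<open>v\<close> is summed out. The result is symmetric in \<open>f\<close>
  and \<open>g\<close>, and a weighted sum of squares when they agree; self-adjointness and
  positivity are read off from it.\<close>

lemma ising_E_heat_bath:
  assumes v: "v < n"
  shows "2 * ising_E n E J (\<lambda>\<sigma>. g \<sigma> * heat_bath (ising_mu n E J) v f \<sigma>) =
    (\<Sum>\<sigma>\<in>spins n. (ising_mu n E J (\<sigma>(v := 1)) + ising_mu n E J (\<sigma>(v := -1))) *
       (heat_bath (ising_mu n E J) v g \<sigma> * heat_bath (ising_mu n E J) v f \<sigma>))"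
  unfolding ising_E_def sum_spins_site[OF v]
proof (rule sum.cong[OF refl])
  fix \<sigma>
  let ?W = "ising_mu n E J"
  let ?S = "?W (\<sigma>(v := 1)) + ?W (\<sigma>(v := -1))"
  have "?S > 0" by (intro add_pos_pos ising_mu_pos)
  then have *: "?S * heat_bath ?W v g \<sigma> = ?W (\<sigma>(v := 1)) * g (\<sigma>(v := 1)) + ?W (\<sigma>(v := -1)) * g (\<sigma>(v := -1))"
    unfolding heat_bath_def[of ?W v g] by simp
  show "?W (\<sigma>(v := 1)) * (g (\<sigma>(v := 1)) * heat_bath ?W v f (\<sigma>(v := 1))) +
        ?W (\<sigma>(v := -1)) * (g (\<sigma>(v := -1)) * heat_bath ?W v f (\<sigma>(v := -1)))
      = ?S * (heat_bath ?W v g \<sigma> * heat_bath ?W v f \<sigma>)"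
    unfolding mult.assoc[symmetric] * heat_bath_upd by (simp add: algebra_simps)
qed

lemma heat_bath_self_adjoint:
  assumes "v < n"
  shows "ising_E n E J (\<lambda>\<sigma>. g \<sigma> * heat_bath (ising_mu n E J) v f \<sigma>)
       = ising_E n E J (\<lambda>\<sigma>. heat_bath (ising_mu n E J) v g \<sigma> * f \<sigma>)"
proof -
  have "2 * ising_E n E J (\<lambda>\<sigma>. g \<sigma> * heat_bath (ising_mu n E J) v f \<sigma>)
      = 2 * ising_E n E J (\<lambda>\<sigma>. f \<sigma> * heat_bath (ising_mu n E J) v g \<sigma>)"
    unfolding ising_E_heat_bath[OF assms] by (simp add: mult.commute)
  then show ?thesis by (simp add: mult.commute)
qed

lemma heat_bath_nonneg_definite:
  assumes "v < n"
  shows "ising_E n E J (\<lambda>\<sigma>. g \<sigma> * heat_bath (ising_mu n E J) v g \<sigma>) \<ge> 0"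
proof -
  have "2 * ising_E n E J (\<lambda>\<sigma>. g \<sigma> * heat_bath (ising_mu n E J) v g \<sigma>) \<ge> 0"
    unfolding ising_E_heat_bath[OF assms]
    by (intro sum_nonneg mult_nonneg_nonneg[OF _ zero_le_square] add_nonneg_nonneg ising_mu_nonneg)
  then show ?thesis by simp
qed

lemma heat_bath_stationary:
  assumes "v < n"
  shows "ising_E n E J (heat_bath (ising_mu n E J) v f) = ising_E n E J f"
  using heat_bath_self_adjoint[OF assms, of E J "\<lambda>_. 1" f] by (simp add: heat_bath_const ising_mu_pos)

lemma ising_E_glauber_op:
  "ising_E n E J (\<lambda>\<sigma>. g \<sigma> * glauber_op n W f \<sigma>) = (\<Sum>v<n. ising_E n E J (\<lambda>\<sigma>. g \<sigma> * heat_bath W v f \<sigma>)) / real n"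
proof -
  have "ising_E n E J (\<lambda>\<sigma>. g \<sigma> * glauber_op n W f \<sigma>) = ising_E n E J (\<lambda>\<sigma>. 1 / real n * (\<Sum>v<n. g \<sigma> * heat_bath W v f \<sigma>))"
    unfolding glauber_op_def by (simp flip: sum_distrib_left)
  then show ?thesis unfolding ising_E_cmult ising_E_sum by simp
qed

lemma glauber_op_self_adjoint:
  "ising_E n E J (\<lambda>\<sigma>. g \<sigma> * glauber_op n (ising_mu n E J) f \<sigma>)
     = ising_E n E J (\<lambda>\<sigma>. glauber_op n (ising_mu n E J) g \<sigma> * f \<sigma>)"
proof -
  let ?P = "glauber_op n (ising_mu n E J)"
  have "ising_E n E J (\<lambda>\<sigma>. g \<sigma> * ?P f \<sigma>) = ising_E n E J (\<lambda>\<sigma>. f \<sigma> * ?P g \<sigma>)"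
    unfolding ising_E_glauber_op
    using heat_bath_self_adjoint[of _ n E J g f] by (simp add: mult.commute)
  then show ?thesis by (simp add: mult.commute)
qed

lemma glauber_op_nonneg_definite:
  "ising_E n E J (\<lambda>\<sigma>. g \<sigma> * glauber_op n (ising_mu n E J) g \<sigma>) \<ge> 0"
  unfolding ising_E_glauber_op
  by (intro divide_nonneg_nonneg sum_nonneg heat_bath_nonneg_definite) auto

lemma glauber_op_stationary:
  assumes "n > 0"
  shows "ising_E n E J ((glauber_op n (ising_mu n E J) ^^ t) f) = ising_E n E J f"
proof (induction t)
  case (Suc t)
  then show ?case
    using glauber_op_self_adjoint[of n E J "\<lambda>_. 1" "(glauber_op n (ising_mu n E J) ^^ t) f"] assms
    by (simp add: glauber_op_const ising_mu_pos)
qed simp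

section \<open>Autocorrelations and mean square displacement\<close>

definition autocor :: "nat \<Rightarrow> nat set set \<Rightarrow> (nat set \<Rightarrow> real) \<Rightarrow> ((nat \<Rightarrow> int) \<Rightarrow> real) \<Rightarrow> nat \<Rightarrow> real" where
  "autocor n E J f k = ising_E n E J (\<lambda>\<sigma>. f \<sigma> * (glauber_op n (ising_mu n E J) ^^ k) f \<sigma>)"

text \<open>Self-adjointness moves one power at a time to the other factor.\<close>

lemma autocor_add:
  "autocor n E J f (i + j) =
    ising_E n E J (\<lambda>\<sigma>. (glauber_op n (ising_mu n E J) ^^ i) f \<sigma> * (glauber_op n (ising_mu n E J) ^^ j) f \<sigma>)"
proof (induction i arbitrary: j)
  case 0
  then show ?case by (simp add: autocor_def)
next
  case (Suc i)
  have "autocor n E J f (Suc i + j) = autocor n E J f (i + Suc j)" by simp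
  also have "\<dots> = ising_E n E J (\<lambda>\<sigma>. (glauber_op n (ising_mu n E J) ^^ i) f \<sigma> *
      glauber_op n (ising_mu n E J) ((glauber_op n (ising_mu n E J) ^^ j) f) \<sigma>)"
    by (subst Suc.IH) simp
  finally show ?case by (simp add: glauber_op_self_adjoint)
qed

text \<open>With \<open>h = P^j f - P^(j+1) f\<close>, the second difference at \<open>k\<close> is
  the squared norm of \<open>h\<close> if \<open>k = 2j\<close>, and the quadratic form of
  \<open>P\<close> at \<open>h\<close> if \<open>k = 2j + 1\<close>. Positivity of \<open>P\<close>
  enters in the odd case.\<close>

lemma autocor_convex:
  "autocor n E J f (Suc k) - autocor n E J f (Suc (Suc k)) \<le> autocor n E J f k - autocor n E J f (Suc k)"
proof -
  let ?P = "glauber_op n (ising_mu n E J)" and ?a = "autocor n E J f"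
  define j where "j = k div 2"
  define h where "h = (\<lambda>\<sigma>. (?P ^^ j) f \<sigma> - (?P ^^ Suc j) f \<sigma>)"
  have Ph: "?P h = (\<lambda>\<sigma>. (?P ^^ Suc j) f \<sigma> - (?P ^^ Suc (Suc j)) f \<sigma>)"
    unfolding h_def glauber_op_diff by simp
  show ?thesis
  proof (cases "even k")
    case True
    then have k: "k = j + j" unfolding j_def by presburger
    have "0 \<le> ising_E n E J (\<lambda>\<sigma>. h \<sigma> * h \<sigma>)"
      using ising_E_mono[of n "\<lambda>_. 0" "\<lambda>\<sigma>. h \<sigma> * h \<sigma>" E J] by simp
    also have "\<dots> = ?a (j + j) - ?a (Suc j + j) - ?a (j + Suc j) + ?a (Suc j + Suc j)"
      unfolding autocor_add h_def by (simp add: algebra_simps ising_E_add ising_E_diff ising_E_cmult)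
    finally show ?thesis by (simp add: k)
  next
    case False
    then have k: "k = j + Suc j" unfolding j_def by presburger
    have "0 \<le> ising_E n E J (\<lambda>\<sigma>. h \<sigma> * ?P h \<sigma>)"
      by (rule glauber_op_nonneg_definite)
    also have "\<dots> = ?a (j + Suc j) - ?a (Suc j + Suc j) - ?a (j + Suc (Suc j)) + ?a (Suc j + Suc (Suc j))"
      unfolding Ph unfolding autocor_add h_def
      by (simp add: algebra_simps ising_E_add ising_E_diff ising_E_cmult del: funpow.simps)
    finally show ?thesis by (simp add: k)
  qed
qed

text \<open>By convexity the decrements decrease, so each of the \<open>t\<close> decrements is at
  most the first.\<close>

lemma autocor_drop:
  "autocor n E J f 0 - autocor n E J f t \<le> real t * (autocor n E J f 0 - autocor n E J f 1)"
proof -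
  let ?a = "autocor n E J f"
  have step: "?a k - ?a (Suc k) \<le> ?a 0 - ?a 1" for k
  proof (induction k)
    case (Suc k)
    then show ?case using autocor_convex[of n E J f k] by linarith
  qed simp
  show ?thesis
  proof (induction t)
    case (Suc t)
    then show ?case using step[of t] by (simp add: algebra_simps)
  qed simp
qed

definition displacement :: "nat \<Rightarrow> nat set set \<Rightarrow> (nat set \<Rightarrow> real) \<Rightarrow> ((nat \<Rightarrow> int) \<Rightarrow> real) \<Rightarrow> nat \<Rightarrow> real" where
  "displacement n E J f t =
     ising_E n E J (\<lambda>\<sigma>. \<Sum>y\<in>spins n. glauber_dist n E J \<sigma> t y * (f \<sigma> - f y)\<^sup>2)"

text \<open>When the square is expanded, stationarity makes the two diagonal terms equal, both
  \<open>autocor n E J f 0\<close>.\<close>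

lemma displacement_eq_autocor:
  assumes n: "n > 0"
  shows "displacement n E J f t = 2 * (autocor n E J f 0 - autocor n E J f t)"
proof -
  let ?P = "glauber_op n (ising_mu n E J)"
  have "displacement n E J f t =
      ising_E n E J (\<lambda>\<sigma>. (f \<sigma> * f \<sigma> - 2 * (f \<sigma> * (?P ^^ t) f \<sigma>)) + (?P ^^ t) (\<lambda>y. (f y)\<^sup>2) \<sigma>)"
    unfolding displacement_def
  proof (rule ising_E_cong)
    fix \<sigma> assume \<sigma>: "\<sigma> \<in> spins n"
    let ?d = "glauber_dist n E J \<sigma> t"
    have "(\<Sum>y\<in>spins n. ?d y * (f \<sigma> - f y)\<^sup>2)
       = (\<Sum>y\<in>spins n. f \<sigma> * f \<sigma> * ?d y - 2 * f \<sigma> * (?d y * f y) + ?d y * (f y)\<^sup>2)"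
      by (rule sum.cong) (auto simp: power2_eq_square algebra_simps)
    also have "\<dots> = f \<sigma> * f \<sigma> * (\<Sum>y\<in>spins n. ?d y) - 2 * f \<sigma> * (\<Sum>y\<in>spins n. ?d y * f y)
        + (\<Sum>y\<in>spins n. ?d y * (f y)\<^sup>2)"
      by (simp add: sum.distrib sum_subtractf flip: sum_distrib_left)
    finally show "(\<Sum>y\<in>spins n. ?d y * (f \<sigma> - f y)\<^sup>2) =
        (f \<sigma> * f \<sigma> - 2 * (f \<sigma> * (?P ^^ t) f \<sigma>)) + (?P ^^ t) (\<lambda>y. (f y)\<^sup>2) \<sigma>"
      unfolding glauber_dist_eq_op[OF \<sigma>] sum_glauber_dist[OF \<sigma> n] by simp
  qed
  then show ?thesis
    unfolding ising_E_add ising_E_diff ising_E_cmult glauber_op_stationary[OF n]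
    by (simp add: autocor_def power2_eq_square)
qed

lemma heat_bath_le:
  assumes "\<And>\<sigma>. W \<sigma> > 0" "f (\<sigma>(v := 1)) \<le> c" "f (\<sigma>(v := -1)) \<le> c"
  shows "heat_bath W v f \<sigma> \<le> c"
proof -
  let ?S = "W (\<sigma>(v := 1)) + W (\<sigma>(v := -1))"
  have S: "?S > 0" by (intro add_pos_pos assms)
  have "W (\<sigma>(v := 1)) * f (\<sigma>(v := 1)) + W (\<sigma>(v := -1)) * f (\<sigma>(v := -1)) \<le> W (\<sigma>(v := 1)) * c + W (\<sigma>(v := -1)) * c"
    by (intro add_mono mult_left_mono assms less_imp_le)
  then show ?thesis unfolding heat_bath_def using S by (simp add: field_simps)
qed

section \<open>Displacement of the magnetization\<close>

definition magnetization :: "nat \<Rightarrow> (nat \<Rightarrow> int) \<Rightarrow> real" where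
  "magnetization n \<sigma> = (\<Sum>i<n. real_of_int (\<sigma> i))"

lemma magnetization_upd:
  assumes "v < n"
  shows "magnetization n (\<sigma>(v := s)) = magnetization n \<sigma> + (real_of_int s - real_of_int (\<sigma> v))"
proof -
  have "magnetization n (\<sigma>(v := s)) = real_of_int s + (\<Sum>i\<in>{..<n}-{v}. real_of_int (\<sigma> i))"
    unfolding magnetization_def using assms by (subst sum.remove[of _ v]) (auto intro!: sum.cong)
  moreover have "magnetization n \<sigma> = real_of_int (\<sigma> v) + (\<Sum>i\<in>{..<n}-{v}. real_of_int (\<sigma> i))"
    unfolding magnetization_def using assms by (subst sum.remove[of _ v]) auto
  ultimately show ?thesis by simp
qed

text \<open>One update alters at most one spin and hence moves the magnetization by at most
  2.\<close>

lemma displacement_magnetization_step: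
  assumes n: "n > 0"
  shows "displacement n E J (magnetization n) 1 \<le> 4"
proof -
  let ?W = "ising_mu n E J" and ?M = "magnetization n"
  have "displacement n E J ?M 1 = ising_E n E J (\<lambda>\<sigma>. glauber_op n ?W (\<lambda>y. (?M \<sigma> - ?M y)\<^sup>2) \<sigma>)"
    unfolding displacement_def by (rule ising_E_cong) (subst glauber_dist_eq_op, auto)
  also have "\<dots> \<le> ising_E n E J (\<lambda>_. 4)"
  proof (rule ising_E_mono)
    fix \<sigma> assume \<sigma>: "\<sigma> \<in> spins n"
    have "heat_bath ?W v (\<lambda>y. (?M \<sigma> - ?M y)\<^sup>2) \<sigma> \<le> 4" if "v < n" for v
      using spins_cases[OF \<sigma> that]
      by (intro heat_bath_le ising_mu_pos) (auto simp: magnetization_upd[OF that] power2_eq_square)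
    then have "(\<Sum>v<n. heat_bath ?W v (\<lambda>y. (?M \<sigma> - ?M y)\<^sup>2) \<sigma>) \<le> (\<Sum>v<n. 4)"
      by (intro sum_mono) auto
    then show "glauber_op n ?W (\<lambda>y. (?M \<sigma> - ?M y)\<^sup>2) \<sigma> \<le> 4"
      unfolding glauber_op_def using n by (simp add: field_simps)
  qed
  finally show ?thesis by simp
qed

lemma displacement_magnetization:
  assumes n: "n > 0"
  shows "displacement n E J (magnetization n) t \<le> 4 * real t"
proof -
  let ?a = "autocor n E J (magnetization n)"
  have "displacement n E J (magnetization n) t \<le> real t * (2 * (?a 0 - ?a 1))"
    using autocor_drop[of n E J "magnetization n" t]
    unfolding displacement_eq_autocor[OF n] mult.left_commute[of "real t"] by simp
  also have "\<dots> \<le> real t * 4"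
    using displacement_magnetization_step[OF n, of E J]
    by (intro mult_left_mono) (auto simp: displacement_eq_autocor[OF n])
  finally show ?thesis by simp
qed

section \<open>Monotonicity\<close>

text \<open>\<open>ratio\<close> compares the odds of plus at \<open>v\<close> under
  \<open>W\<close> at \<open>\<sigma>\<close> and under \<open>W'\<close> at \<open>\<tau>\<close>.
  Raising the configuration and then shifting mass from minus to plus both increase
  \<open>f\<close>. Allowing two weights covers attractiveness as well as the comparison with a
  decoupled model.\<close>

lemma heat_bath_mono:
  assumes f: "mono_on (spins n) f" and v: "v < n"
    and \<sigma>: "\<sigma> \<in> spins n" and \<tau>: "\<tau> \<in> spins n" and le: "\<sigma> \<le> \<tau>"
    and W: "\<And>\<sigma>. W \<sigma> > 0" and W': "\<And>\<sigma>. W' \<sigma> > 0"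
    and ratio: "W (\<sigma>(v := 1)) * W' (\<tau>(v := -1)) \<le> W' (\<tau>(v := 1)) * W (\<sigma>(v := -1))"
  shows "heat_bath W v f \<sigma> \<le> heat_bath W' v f \<tau>"
proof -
  define p where "p = W (\<sigma>(v := 1)) / (W (\<sigma>(v := 1)) + W (\<sigma>(v := -1)))"
  define q where "q = W' (\<tau>(v := 1)) / (W' (\<tau>(v := 1)) + W' (\<tau>(v := -1)))"
  have pos: "W (\<sigma>(v := 1)) + W (\<sigma>(v := -1)) > 0" "W' (\<tau>(v := 1)) + W' (\<tau>(v := -1)) > 0"
    by (intro add_pos_pos W W')+
  have pq: "p \<le> q"
    unfolding p_def q_def using pos ratio by (simp add: divide_simps algebra_simps)
  have p: "0 \<le> p" "p \<le> 1"
    unfolding p_def using pos W less_imp_le[OF W] by (auto simp: divide_simps)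
  have hb: "heat_bath W v f \<sigma> = p * f (\<sigma>(v := 1)) + (1 - p) * f (\<sigma>(v := -1))"
      "heat_bath W' v f \<tau> = q * f (\<tau>(v := 1)) + (1 - q) * f (\<tau>(v := -1))"
    unfolding heat_bath_def p_def q_def using pos by (simp_all add: divide_simps)
  have up: "\<sigma>(v := s) \<le> \<tau>(v := s)" for s
    using le by (auto simp: le_fun_def)
  have "p * f (\<sigma>(v := 1)) + (1 - p) * f (\<sigma>(v := -1)) \<le> p * f (\<tau>(v := 1)) + (1 - p) * f (\<tau>(v := -1))"
    using p v \<sigma> \<tau> up by (intro add_mono mult_left_mono mono_onD[OF f]) auto
  moreover have "(q - p) * f (\<tau>(v := -1)) \<le> (q - p) * f (\<tau>(v := 1))"
    using pq v \<tau> by (intro mult_left_mono mono_onD[OF f]) (auto simp: le_fun_def)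
  ultimately show ?thesis unfolding hb by (simp add: algebra_simps)
qed

text \<open>Free boundary on the complement of \<open>U\<close>. Couplings touching \<open>U\<close>
  are set to 0 instead of being removed from \<open>E\<close>, so that
  \<open>griffiths_second\<close> compares both models on the same edge set. Spins on
  \<open>U\<close> become independent fair signs.\<close>

definition decouple :: "nat set \<Rightarrow> (nat set \<Rightarrow> real) \<Rightarrow> nat set \<Rightarrow> real" where
  "decouple U J e = (if e \<inter> U = {} then J e else 0)"

definition plus_on :: "nat set \<Rightarrow> (nat \<Rightarrow> int) \<Rightarrow> nat \<Rightarrow> int" where
  "plus_on U \<sigma> = (\<lambda>i. if i \<in> U then 1 else \<sigma> i)"

lemma plus_on_in_spins:
  assumes "\<sigma> \<in> spins n" "U \<subseteq> {..<n}"
  shows "plus_on U \<sigma> \<in> spins n"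
  using assms unfolding spins_def plus_on_def by (auto simp: PiE_def Pi_def extensional_def)

text \<open>The differences are the log-odds of plus at \<open>v\<close>. Edges avoiding
  \<open>v\<close> cancel; edges from \<open>v\<close> to \<open>U\<close> contribute 0 on the left
  and \<open>2 * J e\<close> on the right; the others are ordered because
  \<open>\<sigma> \<le> \<tau>\<close>.\<close>

lemma ising_H_gap_mono:
  assumes G: "is_graph n E" and J: "\<And>e. e \<in> E \<Longrightarrow> J e \<ge> 0"
    and le: "\<sigma> \<le> \<tau>" and v: "v \<notin> U" and \<tau>: "\<And>u. u \<in> U \<Longrightarrow> \<tau> u = 1"
  shows "ising_H E (decouple U J) (\<sigma>(v := 1)) - ising_H E (decouple U J) (\<sigma>(v := -1))
       \<le> ising_H E J (\<tau>(v := 1)) - ising_H E J (\<tau>(v := -1))"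
  unfolding ising_H_def sum_subtractf[symmetric]
proof (rule sum_mono)
  fix e assume e: "e \<in> E"
  let ?gap = "\<lambda>J \<sigma>. J e * (\<Prod>i\<in>e. real_of_int ((\<sigma>(v := 1)) i)) - J e * (\<Prod>i\<in>e. real_of_int ((\<sigma>(v := -1)) i))"
  show "?gap (decouple U J) \<sigma> \<le> ?gap J \<tau>"
  proof (cases "v \<in> e")
    case True
    then obtain u where u: "e = {v, u}" "u \<noteq> v"
      using G e unfolding is_graph_def by fastforce
    have \<sigma>\<tau>: "real_of_int (\<sigma> u) \<le> real_of_int (\<tau> u)" using le by (simp add: le_fun_def)
    have "J e * real_of_int (\<sigma> u) \<le> J e * real_of_int (\<tau> u)"
      using J[OF e] \<sigma>\<tau> by (intro mult_left_mono)
    then show ?thesis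
      using u v \<tau>[of u] J[OF e] unfolding decouple_def by (auto simp: mult.commute)
  next
    case False
    then have "(\<Prod>i\<in>e. real_of_int ((\<rho>(v := s)) i)) = (\<Prod>i\<in>e. real_of_int (\<rho> i))" for \<rho> s
      by (intro prod.cong) auto
    then show ?thesis by simp
  qed
qed

text \<open>Exponentiating the log-odds comparison gives the \<open>ratio\<close> condition of
  \<open>heat_bath_mono\<close>. With \<open>U = {}\<close> this is attractiveness of the Glauber
  dynamics.\<close>

lemma heat_bath_decouple_le:
  assumes G: "is_graph n E" and J: "\<And>e. e \<in> E \<Longrightarrow> J e \<ge> 0"
    and f: "mono_on (spins n) f" and v: "v < n" "v \<notin> U"
    and \<sigma>: "\<sigma> \<in> spins n" and \<tau>: "\<tau> \<in> spins n" and le: "\<sigma> \<le> \<tau>" and U: "\<And>u. u \<in> U \<Longrightarrow> \<tau> u = 1"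
  shows "heat_bath (ising_mu n E (decouple U J)) v f \<sigma> \<le> heat_bath (ising_mu n E J) v f \<tau>"
proof (rule heat_bath_mono[OF f v(1) \<sigma> \<tau> le ising_mu_pos ising_mu_pos])
  let ?J' = "decouple U J"
  have "exp (ising_H E ?J' (\<sigma>(v := 1)) + ising_H E J (\<tau>(v := -1)))
      \<le> exp (ising_H E J (\<tau>(v := 1)) + ising_H E ?J' (\<sigma>(v := -1)))"
    using ising_H_gap_mono[where J = J, OF G J le v(2) U] by simp
  then show "ising_mu n E ?J' (\<sigma>(v := 1)) * ising_mu n E J (\<tau>(v := -1))
      \<le> ising_mu n E J (\<tau>(v := 1)) * ising_mu n E ?J' (\<sigma>(v := -1))"
    unfolding ising_mu_def using ising_Z_pos[of n E J] ising_Z_pos[of n E ?J']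
    by (simp add: exp_add divide_simps mult_ac)
qed

lemma decouple_empty [simp]: "decouple {} J = J"
  unfolding decouple_def by auto

lemma heat_bath_mono_on:
  assumes "is_graph n E" "\<And>e. e \<in> E \<Longrightarrow> J e \<ge> 0" "mono_on (spins n) f" "v < n"
  shows "mono_on (spins n) (heat_bath (ising_mu n E J) v f)"
  using heat_bath_decouple_le[where U = "{}", OF assms(1,2,3,4)] by (auto intro!: mono_onI)

lemma path_mono_on:
  assumes "is_graph n E" "\<And>e. e \<in> E \<Longrightarrow> J e \<ge> 0" "mono_on (spins n) f" "set w \<subseteq> {..<n}"
  shows "mono_on (spins n) (foldr (heat_bath (ising_mu n E J)) w f)"
  using assms(4) by (induction w) (auto intro!: heat_bath_mono_on assms(1,2) simp: assms(3))

lemma glauber_op_mono_on: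
  assumes "is_graph n E" "\<And>e. e \<in> E \<Longrightarrow> J e \<ge> 0" "mono_on (spins n) f"
  shows "mono_on (spins n) ((glauber_op n (ising_mu n E J) ^^ t) f)"
proof (rule mono_onI)
  fix \<sigma> \<tau> assume *: "\<sigma> \<in> spins n" "\<tau> \<in> spins n" "\<sigma> \<le> \<tau>"
  show "(glauber_op n (ising_mu n E J) ^^ t) f \<sigma> \<le> (glauber_op n (ising_mu n E J) ^^ t) f \<tau>"
    unfolding glauber_op_funpow_path
    by (intro divide_right_mono sum_mono mono_onD[OF path_mono_on[OF assms]] *) auto
qed

lemma ising_mu_decouple_plus_on:
  "ising_mu n E (decouple U J) (plus_on U \<sigma>) = ising_mu n E (decouple U J) \<sigma>"
proof -
  have "decouple U J e * (\<Prod>v\<in>e. real_of_int (plus_on U \<sigma> v)) = decouple U J e * (\<Prod>v\<in>e. real_of_int (\<sigma> v))" for e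
  proof (cases "e \<inter> U = {}")
    case True
    then have "(\<Prod>v\<in>e. real_of_int (plus_on U \<sigma> v)) = (\<Prod>v\<in>e. real_of_int (\<sigma> v))"
      by (intro prod.cong) (auto simp: plus_on_def)
    then show ?thesis by simp
  qed (simp add: decouple_def)
  then show ?thesis unfolding ising_mu_def ising_H_def by (simp only:)
qed

text \<open>Updates off \<open>U\<close> commute with setting the spins of \<open>U\<close> to plus,
  because the decoupled weight ignores those spins.\<close>

lemma heat_bath_plus_on:
  assumes "v \<notin> U"
  shows "heat_bath (ising_mu n E (decouple U J)) v f (plus_on U \<sigma>)
       = heat_bath (ising_mu n E (decouple U J)) v (\<lambda>\<sigma>. f (plus_on U \<sigma>)) \<sigma>"
proof -
  have "(plus_on U \<sigma>)(v := s) = plus_on U (\<sigma>(v := s))" for s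
    using assms unfolding plus_on_def by auto
  then show ?thesis unfolding heat_bath_def by (simp add: ising_mu_decouple_plus_on)
qed

text \<open>Compares the dynamics that never touches \<open>U\<close>, started from all-plus, with the stationary
  law of the model with free boundary on the complement of \<open>U\<close>.\<close>

lemma path_ge_decoupled:
  assumes G: "is_graph n E" and J: "\<And>e. e \<in> E \<Longrightarrow> J e \<ge> 0"
    and f: "mono_on (spins n) f" and U: "U \<subseteq> {..<n}" and w: "set w \<subseteq> {..<n} - U"
  shows "ising_E n E (decouple U J) (\<lambda>\<sigma>. f (plus_on U \<sigma>))
       \<le> foldr (heat_bath (ising_mu n E J)) w f (all_plus n)"
proof -
  let ?K = "heat_bath (ising_mu n E J)" and ?E = "ising_E n E (decouple U J)"
  have "?E (\<lambda>\<sigma>. f (plus_on U \<sigma>)) \<le> ?E (\<lambda>\<sigma>. foldr ?K w f (plus_on U \<sigma>))"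
    using w
  proof (induction w)
    case (Cons v w)
    then have v: "v < n" "v \<notin> U" and w: "set w \<subseteq> {..<n} - U" by auto
    let ?g = "foldr ?K w f"
    have g: "mono_on (spins n) ?g"
      using w by (intro path_mono_on G J f) auto
    have "?E (\<lambda>\<sigma>. f (plus_on U \<sigma>)) \<le> ?E (\<lambda>\<sigma>. ?g (plus_on U \<sigma>))"
      using Cons.IH w by simp
    \<comment> \<open>The decoupled law is stationary under an update at \<open>v\<close>, so one
      such update can be inserted at no cost and then replaced by the real one.\<close>
    also have "\<dots> = ?E (\<lambda>\<sigma>. heat_bath (ising_mu n E (decouple U J)) v ?g (plus_on U \<sigma>))"
      by (simp add: heat_bath_plus_on[OF v(2)] heat_bath_stationary[OF v(1)])
    also have "\<dots> \<le> ?E (\<lambda>\<sigma>. ?K v ?g (plus_on U \<sigma>))"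
      by (intro ising_E_mono heat_bath_decouple_le[OF G J g v])
        (auto simp: plus_on_in_spins U, simp add: plus_on_def)
    finally show ?case by simp
  qed simp
  also have "\<dots> \<le> ?E (\<lambda>\<sigma>. foldr ?K w f (all_plus n))"
  proof (rule ising_E_mono)
    fix \<sigma> assume "\<sigma> \<in> spins n"
    then have "plus_on U \<sigma> \<in> spins n" using U by (rule plus_on_in_spins)
    then show "foldr ?K w f (plus_on U \<sigma>) \<le> foldr ?K w f (all_plus n)"
      using w by (intro mono_onD[OF path_mono_on[OF G J f]] le_all_plus) auto
  qed
  finally show ?thesis by simp
qed

section \<open>Griffiths' inequalities\<close>

lemma prod_spins_cases:
  assumes \<sigma>: "\<sigma> \<in> spins n" and A: "A \<subseteq> {..<n}"
  shows "(\<Prod>i\<in>A. real_of_int (\<sigma> i)) = 1 \<or> (\<Prod>i\<in>A. real_of_int (\<sigma> i)) = -1"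
proof -
  have "finite A" using A finite_subset by blast
  then show ?thesis using A
  proof (induction A rule: finite_induct)
    case (insert x A)
    then show ?case using spins_cases[OF \<sigma>, of x] by auto
  qed simp
qed

text \<open>Sites in the intersection contribute a squared spin, which is 1.\<close>

lemma prod_spins_mult:
  assumes \<sigma>: "\<sigma> \<in> spins n" and A: "A \<subseteq> {..<n}" and B: "B \<subseteq> {..<n}"
  shows "(\<Prod>i\<in>A. real_of_int (\<sigma> i)) * (\<Prod>i\<in>B. real_of_int (\<sigma> i))
       = (\<Prod>i\<in>(A - B) \<union> (B - A). real_of_int (\<sigma> i))"
proof -
  let ?\<chi> = "\<lambda>A. \<Prod>i\<in>A. real_of_int (\<sigma> i)"
  have fin: "finite A" "finite B" using A B finite_subset by blast+
  have split: "?\<chi> C = ?\<chi> (C - D) * ?\<chi> (C \<inter> D)" if "finite C" for C D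
  proof -
    have "(C - D) \<inter> (C \<inter> D) = {}" by auto
    then show ?thesis
      using prod.union_disjoint[of "C - D" "C \<inter> D"] that by (simp add: Un_Diff_Int)
  qed
  have "?\<chi> A * ?\<chi> B = (?\<chi> (A - B) * ?\<chi> (B - A)) * (?\<chi> (A \<inter> B) * ?\<chi> (A \<inter> B))"
    using split[OF fin(1), of B] split[OF fin(2), of A] by (simp add: Int_commute)
  moreover have "?\<chi> (A \<inter> B) * ?\<chi> (A \<inter> B) = 1"
    using prod_spins_cases[OF \<sigma> le_infI1[OF A, of B]] by (elim disjE) simp_all
  moreover have "?\<chi> ((A - B) \<union> (B - A)) = ?\<chi> (A - B) * ?\<chi> (B - A)"
    using fin by (intro prod.union_disjoint) auto
  ultimately show ?thesis by simp
qed

text \<open>For nonempty \<open>A\<close>, summing over one spin in \<open>A\<close> already gives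
  0.\<close>

lemma sum_prod_spins_nonneg:
  assumes A: "A \<subseteq> {..<n}"
  shows "0 \<le> (\<Sum>\<sigma>\<in>spins n. \<Prod>i\<in>A. real_of_int (\<sigma> i))"
proof (cases "A = {}")
  case False
  then obtain v where v: "v \<in> A" "v < n" using A by auto
  have fin: "finite A" using A finite_subset by blast
  have "(\<Prod>i\<in>A. real_of_int ((\<sigma>(v := s)) i)) = real_of_int s * (\<Prod>i\<in>A - {v}. real_of_int (\<sigma> i))" for \<sigma> s
    using v fin by (subst prod.remove[of _ v]) (auto intro!: prod.cong)
  then have "2 * (\<Sum>\<sigma>\<in>spins n. \<Prod>i\<in>A. real_of_int (\<sigma> i)) = 0"
    unfolding sum_spins_site[OF v(2)] by simp
  then show ?thesis by simp
qed simp

text \<open>Edges are peeled off one at a time by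
  \<open>exp (J e * s) = cosh (J e) + s * sinh (J e)\<close> for a sign \<open>s\<close>. Both
  coefficients are nonnegative, and \<open>A\<close> turns into its symmetric difference with
  \<open>e\<close>, so it varies in the induction. The normalization is left out because
  \<open>griffiths_second\<close> uses couplings that depend on a second configuration.\<close>

lemma griffiths_first_unnormalized:
  assumes "finite E" "\<And>e. e \<in> E \<Longrightarrow> e \<subseteq> {..<n}" "\<And>e. e \<in> E \<Longrightarrow> J e \<ge> 0" "A \<subseteq> {..<n}"
  shows "0 \<le> (\<Sum>\<sigma>\<in>spins n. (\<Prod>i\<in>A. real_of_int (\<sigma> i)) * exp (ising_H E J \<sigma>))"
  using assms
proof (induction E arbitrary: A rule: finite_induct)
  case empty
  then show ?case by (simp add: ising_H_def sum_prod_spins_nonneg)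
next
  case (insert e E)
  let ?\<chi> = "\<lambda>A \<sigma>. \<Prod>i\<in>A. real_of_int (\<sigma> i)" and ?B = "(A - e) \<union> (e - A)"
  have e: "e \<subseteq> {..<n}" "J e \<ge> 0" using insert.prems by auto
  have IH: "0 \<le> (\<Sum>\<sigma>\<in>spins n. ?\<chi> A \<sigma> * exp (ising_H E J \<sigma>))" if "A \<subseteq> {..<n}" for A
    using insert.IH insert.prems that by auto
  have "(\<Sum>\<sigma>\<in>spins n. ?\<chi> A \<sigma> * exp (ising_H (insert e E) J \<sigma>))
      = (\<Sum>\<sigma>\<in>spins n. cosh (J e) * (?\<chi> A \<sigma> * exp (ising_H E J \<sigma>)) + sinh (J e) * (?\<chi> ?B \<sigma> * exp (ising_H E J \<sigma>)))"
  proof (rule sum.cong[OF refl])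
    fix \<sigma> assume \<sigma>: "\<sigma> \<in> spins n"
    have "exp (J e * ?\<chi> e \<sigma>) = cosh (J e) + ?\<chi> e \<sigma> * sinh (J e)"
      using prod_spins_cases[OF \<sigma> e(1)] by (auto simp: cosh_plus_sinh cosh_minus_sinh)
    moreover have "ising_H (insert e E) J \<sigma> = J e * ?\<chi> e \<sigma> + ising_H E J \<sigma>"
      unfolding ising_H_def using insert.hyps by simp
    ultimately have "exp (ising_H (insert e E) J \<sigma>) = (cosh (J e) + ?\<chi> e \<sigma> * sinh (J e)) * exp (ising_H E J \<sigma>)"
      by (simp add: exp_add)
    then show "?\<chi> A \<sigma> * exp (ising_H (insert e E) J \<sigma>)
        = cosh (J e) * (?\<chi> A \<sigma> * exp (ising_H E J \<sigma>)) + sinh (J e) * (?\<chi> ?B \<sigma> * exp (ising_H E J \<sigma>))"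
      unfolding prod_spins_mult[OF \<sigma> insert.prems(3) e(1), symmetric] by (simp add: algebra_simps)
  qed
  also have "\<dots> = cosh (J e) * (\<Sum>\<sigma>\<in>spins n. ?\<chi> A \<sigma> * exp (ising_H E J \<sigma>))
      + sinh (J e) * (\<Sum>\<sigma>\<in>spins n. ?\<chi> ?B \<sigma> * exp (ising_H E J \<sigma>))"
    by (simp add: sum.distrib sum_distrib_left)
  also have "\<dots> \<ge> 0"
    using insert.prems(3) e by (intro add_nonneg_nonneg mult_nonneg_nonneg IH) auto
  finally show ?case .
qed

lemma is_graph_finite:
  assumes "is_graph n E"
  shows "finite E" "\<And>e. e \<in> E \<Longrightarrow> e \<subseteq> {..<n}"
proof -
  show sub: "e \<subseteq> {..<n}" if "e \<in> E" for e
    using assms that unfolding is_graph_def by fastforce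
  then have "E \<subseteq> Pow {..<n}" by auto
  then show "finite E" using finite_subset by blast
qed

lemma ising_E_eq_sum_div:
  "ising_E n E J f = (\<Sum>\<sigma>\<in>spins n. f \<sigma> * exp (ising_H E J \<sigma>)) / ising_Z n E J"
  unfolding ising_E_def ising_mu_def by (simp add: sum_divide_distrib mult.commute)

lemma griffiths_first:
  assumes G: "is_graph n E" and J: "\<And>e. e \<in> E \<Longrightarrow> J e \<ge> 0" and A: "A \<subseteq> {..<n}"
  shows "0 \<le> ising_E n E J (\<lambda>\<sigma>. \<Prod>i\<in>A. real_of_int (\<sigma> i))"
  unfolding ising_E_eq_sum_div
  by (intro divide_nonneg_pos ising_Z_pos griffiths_first_unnormalized is_graph_finite[OF G] J A)

section \<open>Duplicated systems and the second inequality\<close>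

definition spin_mult :: "nat \<Rightarrow> (nat \<Rightarrow> int) \<Rightarrow> (nat \<Rightarrow> int) \<Rightarrow> nat \<Rightarrow> int" where
  "spin_mult n \<sigma> \<tau> = (\<lambda>i. if i < n then \<sigma> i * \<tau> i else undefined)"

lemma spin_mult_in_spins:
  assumes "\<sigma> \<in> spins n" "\<tau> \<in> spins n"
  shows "spin_mult n \<sigma> \<tau> \<in> spins n"
proof -
  have "spin_mult n \<sigma> \<tau> i \<in> {-1, 1}" if "i < n" for i
    using spins_cases[OF assms(1) that] spins_cases[OF assms(2) that] that
    unfolding spin_mult_def by auto
  then show ?thesis
    unfolding spins_def by (intro PiE_I) (auto simp: spin_mult_def)
qed

lemma spin_mult_cancel:
  assumes "\<sigma> \<in> spins n" "\<tau> \<in> spins n"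
  shows "spin_mult n \<sigma> (spin_mult n \<sigma> \<tau>) = \<tau>"
proof
  fix i
  show "spin_mult n \<sigma> (spin_mult n \<sigma> \<tau>) i = \<tau> i"
    using spins_cases[OF assms(1), of i] spins_extensional[OF assms(2), of i]
    by (cases "i < n") (auto simp: spin_mult_def)
qed

lemma sum_spin_mult:
  assumes "\<sigma> \<in> spins n"
  shows "(\<Sum>\<tau>\<in>spins n. F (spin_mult n \<sigma> \<tau>)) = (\<Sum>\<tau>\<in>spins n. F \<tau> :: real)"
  by (rule sum.reindex_bij_witness[where i = "spin_mult n \<sigma>" and j = "spin_mult n \<sigma>"])
    (auto simp: assms spin_mult_cancel spin_mult_in_spins)

lemma prod_spin_mult:
  assumes "A \<subseteq> {..<n}"
  shows "(\<Prod>i\<in>A. real_of_int (spin_mult n \<sigma> \<tau> i)) = (\<Prod>i\<in>A. real_of_int (\<sigma> i)) * (\<Prod>i\<in>A. real_of_int (\<tau> i))"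
  unfolding prod.distrib[symmetric] using assms by (intro prod.cong) (auto simp: spin_mult_def)

text \<open>Duplicate the system and substitute \<open>\<sigma>' = \<sigma>\<tau>\<close>: for fixed \<open>\<tau>\<close> the couplings
  \<open>J e + J' e * \<tau> e\<close> are again nonnegative, so the first inequality applies.\<close>

lemma griffiths_second:
  assumes G: "is_graph n E" and J': "\<And>e. e \<in> E \<Longrightarrow> 0 \<le> J' e" and J: "\<And>e. e \<in> E \<Longrightarrow> J' e \<le> J e"
    and A: "A \<subseteq> {..<n}"
  shows "ising_E n E J' (\<lambda>\<sigma>. \<Prod>i\<in>A. real_of_int (\<sigma> i)) \<le> ising_E n E J (\<lambda>\<sigma>. \<Prod>i\<in>A. real_of_int (\<sigma> i))"
proof -
  let ?\<chi> = "\<lambda>A \<sigma>. \<Prod>i\<in>A. real_of_int (\<sigma> i)"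
  let ?S = "\<lambda>J f. \<Sum>\<sigma>\<in>spins n. f \<sigma> * exp (ising_H E J \<sigma>)"
  \<comment> \<open>Cross-multiplying by the partition functions turns the difference of
    expectations into a sum over two independent copies, with couplings \<open>J\<close> and
    \<open>J'\<close>.\<close>
  have "?S J (?\<chi> A) * ising_Z n E J' - ?S J' (?\<chi> A) * ising_Z n E J
      = (\<Sum>\<sigma>\<in>spins n. \<Sum>\<tau>\<in>spins n. (?\<chi> A \<sigma> - ?\<chi> A \<tau>) * exp (ising_H E J \<sigma> + ising_H E J' \<tau>))"
  proof -
    have "?S J (?\<chi> A) * ising_Z n E J' =
        (\<Sum>\<sigma>\<in>spins n. \<Sum>\<tau>\<in>spins n. ?\<chi> A \<sigma> * exp (ising_H E J \<sigma> + ising_H E J' \<tau>))"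
      unfolding ising_Z_def sum_product by (intro sum.cong refl) (simp add: exp_add)
    moreover have "ising_Z n E J * ?S J' (?\<chi> A) =
        (\<Sum>\<sigma>\<in>spins n. \<Sum>\<tau>\<in>spins n. ?\<chi> A \<tau> * exp (ising_H E J \<sigma> + ising_H E J' \<tau>))"
      unfolding ising_Z_def sum_product by (intro sum.cong refl) (simp add: exp_add)
    ultimately show ?thesis
      unfolding left_diff_distrib sum_subtractf by (simp only: mult.commute[of _ "ising_Z n E J"])
  qed
  also have "\<dots> = (\<Sum>\<sigma>\<in>spins n. \<Sum>\<tau>\<in>spins n.
      (?\<chi> A \<sigma> - ?\<chi> A (spin_mult n \<sigma> \<tau>)) * exp (ising_H E J \<sigma> + ising_H E J' (spin_mult n \<sigma> \<tau>)))"
    by (intro sum.cong refl sum_spin_mult[symmetric])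
  also have "\<dots> = (\<Sum>\<sigma>\<in>spins n. \<Sum>\<tau>\<in>spins n.
      (1 - ?\<chi> A \<tau>) * (?\<chi> A \<sigma> * exp (ising_H E (\<lambda>e. J e + J' e * ?\<chi> e \<tau>) \<sigma>)))"
  proof (intro sum.cong refl)
    fix \<sigma> \<tau>
    have "ising_H E J \<sigma> + ising_H E J' (spin_mult n \<sigma> \<tau>) = ising_H E (\<lambda>e. J e + J' e * ?\<chi> e \<tau>) \<sigma>"
      unfolding ising_H_def sum.distrib[symmetric]
      by (intro sum.cong refl) (simp add: prod_spin_mult[OF is_graph_finite(2)[OF G]] algebra_simps)
    then show "(?\<chi> A \<sigma> - ?\<chi> A (spin_mult n \<sigma> \<tau>)) * exp (ising_H E J \<sigma> + ising_H E J' (spin_mult n \<sigma> \<tau>))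
        = (1 - ?\<chi> A \<tau>) * (?\<chi> A \<sigma> * exp (ising_H E (\<lambda>e. J e + J' e * ?\<chi> e \<tau>) \<sigma>))"
      by (simp add: prod_spin_mult[OF A] algebra_simps)
  qed
  also have "\<dots> = (\<Sum>\<tau>\<in>spins n. (1 - ?\<chi> A \<tau>) *
      (\<Sum>\<sigma>\<in>spins n. ?\<chi> A \<sigma> * exp (ising_H E (\<lambda>e. J e + J' e * ?\<chi> e \<tau>) \<sigma>)))"
    by (subst sum.swap) (simp add: sum_distrib_left)
  also have "\<dots> \<ge> 0"
  proof (rule sum_nonneg, rule mult_nonneg_nonneg)
    fix \<tau> assume \<tau>: "\<tau> \<in> spins n"
    show "0 \<le> 1 - ?\<chi> A \<tau>" using prod_spins_cases[OF \<tau> A] by auto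
    have "0 \<le> J e + J' e * ?\<chi> e \<tau>" if e: "e \<in> E" for e
      using prod_spins_cases[OF \<tau> is_graph_finite(2)[OF G e]] J[OF e] J'[OF e] by auto
    then show "0 \<le> (\<Sum>\<sigma>\<in>spins n. ?\<chi> A \<sigma> * exp (ising_H E (\<lambda>e. J e + J' e * ?\<chi> e \<tau>) \<sigma>))"
      by (intro griffiths_first_unnormalized is_graph_finite[OF G] A)
  qed
  finally have "?S J' (?\<chi> A) * ising_Z n E J \<le> ?S J (?\<chi> A) * ising_Z n E J'" by simp
  then show ?thesis
    unfolding ising_E_eq_sum_div using ising_Z_pos[of n E J] ising_Z_pos[of n E J']
    by (simp add: divide_simps mult.commute)
qed

text \<open>The symmetric difference of \<open>{i}\<close> and \<open>{j}\<close> turns the diagonal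
  into the empty product 1, so Griffiths' inequalities apply to all pairs alike.\<close>

lemma ising_E_square_sum:
  assumes "I \<subseteq> {..<n}"
  shows "ising_E n E J (\<lambda>\<sigma>. (\<Sum>i\<in>I. real_of_int (\<sigma> i))\<^sup>2) =
    (\<Sum>i\<in>I. \<Sum>j\<in>I. ising_E n E J (\<lambda>\<sigma>. \<Prod>k\<in>({i} - {j}) \<union> ({j} - {i}). real_of_int (\<sigma> k)))"
  unfolding ising_E_sum[symmetric] power2_eq_square sum_product
proof (intro ising_E_cong sum.cong refl)
  fix \<sigma> i j assume "\<sigma> \<in> spins n" "i \<in> I" "j \<in> I"
  then show "real_of_int (\<sigma> i) * real_of_int (\<sigma> j) = (\<Prod>k\<in>({i} - {j}) \<union> ({j} - {i}). real_of_int (\<sigma> k))"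
    using assms prod_spins_mult[of \<sigma> n "{i}" "{j}"] by auto
qed

text \<open>The second inequality restores the deleted couplings; the first makes all correlations
  nonnegative, so the pairs meeting \<open>U\<close> can be added.\<close>

lemma decoupled_second_moment_le:
  assumes G: "is_graph n E" and J: "\<And>e. e \<in> E \<Longrightarrow> J e \<ge> 0"
  shows "ising_E n E (decouple U J) (\<lambda>\<sigma>. (\<Sum>i\<in>{..<n} - U. real_of_int (\<sigma> i))\<^sup>2)
       \<le> ising_E n E J (\<lambda>\<sigma>. (magnetization n \<sigma>)\<^sup>2)"
proof -
  let ?c = "\<lambda>J i j. ising_E n E J (\<lambda>\<sigma>. \<Prod>k\<in>({i} - {j}) \<union> ({j} - {i}). real_of_int (\<sigma> k))"
  have "(\<Sum>i\<in>{..<n} - U. \<Sum>j\<in>{..<n} - U. ?c (decouple U J) i j)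
      \<le> (\<Sum>i\<in>{..<n} - U. \<Sum>j\<in>{..<n} - U. ?c J i j)"
    by (intro sum_mono griffiths_second G) (auto simp: decouple_def J)
  also have "\<dots> \<le> (\<Sum>i\<in>{..<n} - U. \<Sum>j<n. ?c J i j)"
    by (intro sum_mono sum_mono2 griffiths_first[OF G J]) auto
  also have "\<dots> \<le> (\<Sum>i<n. \<Sum>j<n. ?c J i j)"
    by (intro sum_mono2 sum_nonneg griffiths_first[OF G J]) auto
  finally show ?thesis
    unfolding magnetization_def by (simp only: ising_E_square_sum Diff_subset order_refl)
qed

section \<open>Unvisited vertices\<close>

lemma card_lists_avoiding:
  fixes n t :: nat
  assumes "S \<subseteq> {..<n}"
  shows "card {w. (set w \<subseteq> {..<n} \<and> length w = t) \<and> set w \<inter> S = {}} = (n - card S) ^ t"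
proof -
  have "{w. (set w \<subseteq> {..<n} \<and> length w = t) \<and> set w \<inter> S = {}} = {w. set w \<subseteq> {..<n} - S \<and> length w = t}"
    by auto
  moreover have "card ({..<n} - S) = n - card S"
    using assms finite_subset by (subst card_Diff_subset) auto
  ultimately show ?thesis by (simp add: card_lists_length_eq)
qed

text \<open>Chebyshev's inequality for the number of unvisited vertices, with all
  \<open>n ^ t\<close> selection sequences equally likely. Missing two distinct vertices are
  negatively correlated events, so the variance is at most the mean \<open>\<mu>\<close>, and a
  deviation of \<open>\<mu> / 2\<close> has probability at most \<open>4 / \<mu>\<close>.\<close>

lemma few_unvisited:
  fixes n t :: nat
  defines "\<mu> \<equiv> real n * (1 - 1 / real n) ^ t"
  assumes n: "n \<ge> 2"
  shows "real (card {w. (set w \<subseteq> {..<n} \<and> length w = t) \<and> real (card ({..<n} - set w)) < \<mu> / 2})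
      \<le> 4 * real n ^ t / \<mu>"
proof -
  let ?L = "{w. set w \<subseteq> {..<n} \<and> length w = t}"
  let ?U = "\<lambda>w. real (card ({..<n} - set w))"
  \<comment> \<open>\<open>N\<close>, \<open>a\<close> and \<open>b\<close> count all sequences,
    those missing a given vertex, and those missing two given distinct vertices.\<close>
  define N where "N = real n ^ t"
  define a where "a = (real n - 1) ^ t"
  define b where "b = (real n - 2) ^ t"
  have finL: "finite ?L" by (rule finite_lists_length_eq) simp
  have cardL: "real (card ?L) = N" by (simp add: card_lists_length_eq N_def)
  have \<mu>pos: "\<mu> > 0" unfolding \<mu>_def using n by simp
  have Npos: "N > 0" unfolding N_def using n by simp
  have \<mu>N: "\<mu> * N = real n * a"
  proof -
    have "(1 - 1 / real n) * real n = real n - 1" using n by (simp add: left_diff_distrib)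
    then have "(1 - 1 / real n) ^ t * real n ^ t = (real n - 1) ^ t"
      by (metis power_mult_distrib)
    then show ?thesis unfolding \<mu>_def N_def a_def by simp
  qed
  have U: "?U w = (\<Sum>i<n. of_bool (i \<notin> set w))" for w
    by (simp add: sum.If_cases of_bool_def Int_def Diff_eq Compl_eq)
  have count: "(\<Sum>w\<in>?L. of_bool (set w \<inter> S = {})) = real ((n - card S) ^ t)" if "S \<subseteq> {..<n}" for S
    using finL by (simp add: card_lists_avoiding[OF that, symmetric] of_bool_def sum.If_cases Int_def)
  have count1: "(\<Sum>w\<in>?L. of_bool (i \<notin> set w)) = a" if "i < n" for i
    using count[of "{i}"] that n by (simp add: a_def)
  have count2: "(\<Sum>w\<in>?L. of_bool (i \<notin> set w) * of_bool (j \<notin> set w)) = (if i = j then a else b)" if "i < n" "j < n" for i j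
  proof (cases "i = j")
    case True
    then show ?thesis using count1[OF that(1)] by (simp flip: of_bool_conj)
  next
    case False
    then show ?thesis using count[of "{i, j}"] that n by (simp add: b_def flip: of_bool_conj)
  qed
  have first: "(\<Sum>w\<in>?L. ?U w) = real n * a"
    unfolding U by (subst sum.swap) (simp add: count1)
  have "(\<Sum>w\<in>?L. (?U w)\<^sup>2) = (\<Sum>i<n. \<Sum>j<n. if i = j then a else b)"
  proof -
    have "(\<Sum>w\<in>?L. (?U w)\<^sup>2) = (\<Sum>w\<in>?L. \<Sum>i<n. \<Sum>j<n. of_bool (i \<notin> set w) * of_bool (j \<notin> set w))"
      unfolding U power2_eq_square sum_product ..
    also have "\<dots> = (\<Sum>i<n. \<Sum>j<n. \<Sum>w\<in>?L. of_bool (i \<notin> set w) * of_bool (j \<notin> set w))"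
      by (subst sum.swap) (intro sum.cong refl sum.swap)
    finally show ?thesis using count2 by simp
  qed
  also have "\<dots> = (\<Sum>i<n. (real n - 1) * b + a)"
  proof (rule sum.cong[OF refl])
    fix i assume i: "i \<in> {..<n}"
    have "(\<Sum>j<n. if i = j then a else b) = a + (\<Sum>j\<in>{..<n} - {i}. if i = j then a else b)"
      using i by (subst sum.remove[of _ i]) auto
    also have "(\<Sum>j\<in>{..<n} - {i}. if i = j then a else b) = (\<Sum>j\<in>{..<n} - {i}. b)"
      by (rule sum.cong) auto
    finally show "(\<Sum>j<n. if i = j then a else b) = (real n - 1) * b + a"
      using i n by simp
  qed
  finally have second: "(\<Sum>w\<in>?L. (?U w)\<^sup>2) = real n * a + real n * (real n - 1) * b"
    by (simp add: algebra_simps)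
  \<comment> \<open>Negative correlation, from \<open>n * (n - 2) \<le> (n - 1)^2\<close>.\<close>
  have bN: "b * N \<le> a\<^sup>2"
    unfolding a_def b_def N_def power_mult_distrib[symmetric] power2_eq_square using n
    by (intro power_mono) (auto simp: algebra_simps)
  have "(real n * (real n - 1) * b) * N \<le> (real n)\<^sup>2 * a\<^sup>2"
  proof -
    have "(real n * (real n - 1)) * (b * N) \<le> (real n * real n) * a\<^sup>2"
      using n bN by (intro mult_mono) (auto simp: b_def N_def)
    then show ?thesis by (simp add: power2_eq_square mult_ac)
  qed
  also have "\<dots> = \<mu>\<^sup>2 * N * N"
    unfolding power_mult_distrib[symmetric] \<mu>N[symmetric] by (simp add: power2_eq_square)
  finally have cross: "real n * (real n - 1) * b \<le> \<mu>\<^sup>2 * N" using Npos by simp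
  have "(\<Sum>w\<in>?L. (?U w - \<mu>)\<^sup>2) = (\<Sum>w\<in>?L. (?U w)\<^sup>2) - 2 * \<mu> * (\<Sum>w\<in>?L. ?U w) + N * \<mu>\<^sup>2"
    unfolding cardL[symmetric]
    by (simp add: power2_diff sum.distrib sum_subtractf sum_distrib_left sum_distrib_right mult_ac)
  also have "\<dots> \<le> \<mu> * N"
    unfolding first second \<mu>N[symmetric] using cross by (simp add: power2_eq_square algebra_simps)
  finally have var: "(\<Sum>w\<in>?L. (?U w - \<mu>)\<^sup>2) \<le> \<mu> * N" .
  let ?B = "{w. (set w \<subseteq> {..<n} \<and> length w = t) \<and> ?U w < \<mu> / 2}"
  have "real (card ?B) * (\<mu> / 2)\<^sup>2 = (\<Sum>w\<in>?B. (\<mu> / 2)\<^sup>2)" by simp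
  also have "\<dots> \<le> (\<Sum>w\<in>?B. (?U w - \<mu>)\<^sup>2)"
  proof (rule sum_mono)
    fix w assume "w \<in> ?B"
    then have "(\<mu> / 2)\<^sup>2 \<le> (\<mu> - ?U w)\<^sup>2" using \<mu>pos by (intro power_mono) auto
    then show "(\<mu> / 2)\<^sup>2 \<le> (?U w - \<mu>)\<^sup>2" by (simp add: power2_commute)
  qed
  also have "\<dots> \<le> (\<Sum>w\<in>?L. (?U w - \<mu>)\<^sup>2)"
    by (rule sum_mono2) (auto simp: finL)
  also note var
  finally show ?thesis using \<mu>pos by (simp add: N_def field_simps power2_eq_square)
qed

section \<open>Total variation tests\<close>

text \<open>Both measures have mass 1, so \<open>f\<close> can be centred at 1/2; its distance from
  1/2 is at most 1/2, which is exactly the factor in \<open>tv_dist\<close>.\<close>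

lemma tv_dist_test:
  assumes f: "\<And>x. x \<in> \<Omega> \<Longrightarrow> 0 \<le> f x \<and> f x \<le> 1"
    and \<mu>: "sum \<mu> \<Omega> = 1" and \<nu>: "sum \<nu> \<Omega> = 1"
  shows "(\<Sum>x\<in>\<Omega>. \<mu> x * f x) - (\<Sum>x\<in>\<Omega>. \<nu> x * f x) \<le> tv_dist \<Omega> \<mu> \<nu>"
proof -
  have "(\<Sum>x\<in>\<Omega>. \<mu> x * f x) - (\<Sum>x\<in>\<Omega>. \<nu> x * f x) = (\<Sum>x\<in>\<Omega>. (\<mu> x - \<nu> x) * (f x - 1 / 2))"
    using \<mu> \<nu> by (simp add: algebra_simps sum.distrib sum_subtractf flip: sum_divide_distrib)
  also have "\<dots> \<le> (\<Sum>x\<in>\<Omega>. \<bar>\<mu> x - \<nu> x\<bar> * (1 / 2))"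
  proof (rule sum_mono)
    fix x assume "x \<in> \<Omega>"
    then have "\<bar>f x - 1 / 2\<bar> \<le> 1 / 2" using f by (auto simp: abs_if)
    then have "\<bar>\<mu> x - \<nu> x\<bar> * \<bar>f x - 1 / 2\<bar> \<le> \<bar>\<mu> x - \<nu> x\<bar> * (1 / 2)"
      by (intro mult_left_mono) auto
    then show "(\<mu> x - \<nu> x) * (f x - 1 / 2) \<le> \<bar>\<mu> x - \<nu> x\<bar> * (1 / 2)"
      by (metis abs_ge_self abs_mult order_trans)
  qed
  finally show ?thesis unfolding tv_dist_def by (simp add: sum_distrib_left mult.commute)
qed

lemma glauber_tv_test:
  assumes n: "n > 0" and x: "x \<in> spins n" and f: "\<And>\<sigma>. \<sigma> \<in> spins n \<Longrightarrow> 0 \<le> f \<sigma> \<and> f \<sigma> \<le> 1"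
  shows "(glauber_op n (ising_mu n E J) ^^ t) f x - ising_E n E J f
       \<le> tv_dist (spins n) (glauber_dist n E J x t) (ising_mu n E J)"
  unfolding glauber_dist_eq_op[OF x, symmetric] ising_E_def
  by (intro tv_dist_test f sum_glauber_dist x n sum_ising_mu)

lemma chebyshev:
  assumes "a > 0"
  shows "ising_E n E J (\<lambda>\<sigma>. of_bool (g \<sigma> \<ge> a)) \<le> ising_E n E J (\<lambda>\<sigma>. (g \<sigma>)\<^sup>2) / a\<^sup>2"
proof -
  have "ising_E n E J (\<lambda>\<sigma>. of_bool (g \<sigma> \<ge> a)) \<le> ising_E n E J (\<lambda>\<sigma>. 1 / a\<^sup>2 * (g \<sigma>)\<^sup>2)"
    using assms by (intro ising_E_mono) (auto simp: of_bool_def field_simps intro: power_mono)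
  then show ?thesis unfolding ising_E_cmult by simp
qed

lemma magnetization_mono: "\<sigma> \<le> \<tau> \<Longrightarrow> magnetization n \<sigma> \<le> magnetization n \<tau>"
  unfolding magnetization_def by (intro sum_mono) (simp add: le_fun_def)

lemma magnetization_plus_on:
  assumes "U \<subseteq> {..<n}"
  shows "magnetization n (plus_on U \<sigma>) = real (card U) + (\<Sum>i\<in>{..<n} - U. real_of_int (\<sigma> i))"
proof -
  have "magnetization n (plus_on U \<sigma>) = (\<Sum>i\<in>U. real_of_int (plus_on U \<sigma> i)) + (\<Sum>i\<in>{..<n} - U. real_of_int (plus_on U \<sigma> i))"
    unfolding magnetization_def using assms by (subst sum.subset_diff[of U]) auto
  then show ?thesis by (simp add: plus_on_def)
qed

text \<open>Condition on the selection sequence. Outside a fraction \<open>4 / \<mu>\<close> of the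
  sequences, at least \<open>2 * a\<close> vertices stay plus throughout; in the decoupled model the
  others sum to \<open>- a\<close> or less with probability at most the second moment over
  \<open>a^2\<close>.\<close>

lemma plus_chain_lower_bound:
  fixes n t :: nat
  defines "\<mu> \<equiv> real n * (1 - 1 / real n) ^ t"
  assumes G: "is_graph n E" and J: "\<And>e. e \<in> E \<Longrightarrow> J e \<ge> 0" and n: "n \<ge> 2"
    and a: "a > 0" "4 * a \<le> \<mu>"
  shows "1 - 4 / \<mu> - ising_E n E J (\<lambda>\<sigma>. (magnetization n \<sigma>)\<^sup>2) / a\<^sup>2
    \<le> (glauber_op n (ising_mu n E J) ^^ t) (\<lambda>\<sigma>. of_bool (magnetization n \<sigma> \<ge> a)) (all_plus n)"
proof -
  let ?L = "{w. set w \<subseteq> {..<n} \<and> length w = t}" and ?U = "\<lambda>w. {..<n} - set w"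
  let ?f = "\<lambda>\<sigma>. of_bool (magnetization n \<sigma> \<ge> a) :: real"
  let ?K = "\<lambda>w. foldr (heat_bath (ising_mu n E J)) w ?f (all_plus n)"
  define q where "q = ising_E n E J (\<lambda>\<sigma>. (magnetization n \<sigma>)\<^sup>2) / a\<^sup>2"
  define B where "B = {w\<in>?L. real (card (?U w)) < \<mu> / 2}"
  have finL: "finite ?L" by (rule finite_lists_length_eq) simp
  have cardL: "real (card ?L) = real n ^ t" by (simp add: card_lists_length_eq)
  have BL: "B \<subseteq> ?L" unfolding B_def by auto
  have \<mu>: "\<mu> > 0" using a by simp
  have f: "mono_on (spins n) ?f"
    by (rule mono_onI) (auto simp: of_bool_def dest: order_trans[OF _ magnetization_mono])
  have path: "ising_E n E (decouple (?U w) J) (\<lambda>\<sigma>. ?f (plus_on (?U w) \<sigma>)) \<le> ?K w" if "w \<in> ?L" for w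
    using that by (intro path_ge_decoupled[OF G J f]) auto
  have nonneg: "0 \<le> ?K w" if "w \<in> ?L" for w
    using path[OF that] ising_E_mono[of n "\<lambda>_. 0" "\<lambda>\<sigma>. ?f (plus_on (?U w) \<sigma>)" E "decouple (?U w) J"] by simp
  have good: "1 - q \<le> ?K w" if w: "w \<in> ?L - B" for w
  proof -
    let ?E = "ising_E n E (decouple (?U w) J)"
    let ?S = "\<lambda>\<sigma>. \<Sum>i\<in>{..<n} - ?U w. real_of_int (\<sigma> i)"
    have card: "real (card (?U w)) \<ge> 2 * a" using w a unfolding B_def by auto
    have "?E (\<lambda>\<sigma>. of_bool (- ?S \<sigma> \<ge> a)) \<le> ?E (\<lambda>\<sigma>. (- ?S \<sigma>)\<^sup>2) / a\<^sup>2"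
      by (rule chebyshev[OF a(1)])
    also have "\<dots> \<le> q"
      unfolding q_def power2_minus by (intro divide_right_mono decoupled_second_moment_le[OF G J]) auto
    finally have "1 - q \<le> ?E (\<lambda>\<sigma>. 1 - of_bool (- ?S \<sigma> \<ge> a))" by (simp add: ising_E_diff)
    also have "\<dots> \<le> ?E (\<lambda>\<sigma>. ?f (plus_on (?U w) \<sigma>))"
      using card by (intro ising_E_mono) (auto simp: magnetization_plus_on of_bool_def)
    also have "\<dots> \<le> ?K w" using path w by auto
    finally show ?thesis .
  qed
  have q: "q \<ge> 0"
    unfolding q_def using ising_E_mono[of n "\<lambda>_. 0" "\<lambda>\<sigma>. (magnetization n \<sigma>)\<^sup>2" E J] by simp
  have Kf: "(glauber_op n (ising_mu n E J) ^^ t) ?f (all_plus n) = (\<Sum>w\<in>?L. ?K w) / real n ^ t"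
    by (rule glauber_op_funpow_path)
  have "1 - 4 / \<mu> - q \<le> (\<Sum>w\<in>?L. ?K w) / real n ^ t"
  \<comment> \<open>For \<open>q > 1\<close> the left-hand side is negative; otherwise
    \<open>1 - q\<close> is a nonnegative factor and the good sequences can be counted.\<close>
  proof (cases "q \<le> 1")
    case True
    have cardB: "real (card B) \<le> 4 * real n ^ t / \<mu>"
      using few_unvisited[OF n, of t] unfolding B_def \<mu>_def by simp
    have "1 - r - q \<le> (1 - r) * (1 - q)" if "0 \<le> r" for r
      using q that by (simp add: algebra_simps)
    then have "1 - 4 / \<mu> - q \<le> (1 - 4 / \<mu>) * (1 - q)"
      using \<mu> by simp
    then have "(1 - 4 / \<mu> - q) * real n ^ t \<le> ((1 - 4 / \<mu>) * (1 - q)) * real n ^ t"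
      by (rule mult_right_mono) simp
    also have "\<dots> = (real n ^ t - 4 * real n ^ t / \<mu>) * (1 - q)"
      by (simp add: algebra_simps)
    also have "\<dots> \<le> real (card (?L - B)) * (1 - q)"
      using True cardB card_mono[OF finL BL] finite_subset[OF BL finL]
      by (intro mult_right_mono) (auto simp: card_Diff_subset[OF _ BL] cardL)
    also have "\<dots> = (\<Sum>w\<in>?L - B. 1 - q)" by simp
    also have "\<dots> \<le> (\<Sum>w\<in>?L - B. ?K w)" by (intro sum_mono good)
    also have "\<dots> \<le> (\<Sum>w\<in>?L. ?K w)" using finL nonneg by (intro sum_mono2) auto
    finally show ?thesis using n by (simp add: pos_le_divide_eq)
  next
    case False
    moreover have "4 / \<mu> > 0" using \<mu> by simp
    ultimately have "1 - 4 / \<mu> - q \<le> 0" by linarith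
    also have "0 \<le> (\<Sum>w\<in>?L. ?K w) / real n ^ t"
      by (intro divide_nonneg_nonneg sum_nonneg nonneg) auto
    finally show ?thesis .
  qed
  then show ?thesis unfolding Kf q_def .
qed

section \<open>Large susceptibility\<close>

lemma sum_spins_neg:
  "(\<Sum>\<sigma>\<in>spins n. F (spin_mult n (\<lambda>i. if i < n then -1 else undefined) \<sigma>)) = (\<Sum>\<sigma>\<in>spins n. F \<sigma> :: real)"
  by (rule sum_spin_mult) (unfold spins_def, intro PiE_I, auto)

text \<open>Global spin flip: every edge has exactly two endpoints, so the signs cancel in the
  energy.\<close>

lemma ising_E_neg:
  assumes G: "is_graph n E"
  shows "ising_E n E J (\<lambda>\<sigma>. h (- magnetization n \<sigma>)) = ising_E n E J (\<lambda>\<sigma>. h (magnetization n \<sigma>))"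
proof -
  let ?neg = "spin_mult n (\<lambda>i. if i < n then -1 else undefined)"
  have M: "magnetization n (?neg \<sigma>) = - magnetization n \<sigma>" for \<sigma>
    unfolding magnetization_def by (simp add: spin_mult_def flip: sum_negf)
  have "(\<Prod>v\<in>e. real_of_int (?neg \<sigma> v)) = (\<Prod>v\<in>e. real_of_int (\<sigma> v))" if "e \<in> E" for e \<sigma>
    using G that unfolding is_graph_def by (fastforce simp: spin_mult_def)
  then have "ising_H E J (?neg \<sigma>) = ising_H E J \<sigma>" for \<sigma>
    unfolding ising_H_def by simp
  then have mu: "ising_mu n E J (?neg \<sigma>) = ising_mu n E J \<sigma>" for \<sigma>
    unfolding ising_mu_def by simp
  have "ising_E n E J (\<lambda>\<sigma>. h (magnetization n \<sigma>)) = (\<Sum>\<sigma>\<in>spins n. ising_mu n E J (?neg \<sigma>) * h (magnetization n (?neg \<sigma>)))"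
    unfolding ising_E_def by (rule sum_spins_neg[symmetric])
  then show ?thesis unfolding M mu ising_E_def by simp
qed

lemma prob_magnetization_pos_le_half:
  assumes G: "is_graph n E"
  shows "ising_E n E J (\<lambda>\<sigma>. of_bool (magnetization n \<sigma> > 0)) \<le> 1 / 2"
proof -
  have "2 * ising_E n E J (\<lambda>\<sigma>. of_bool (magnetization n \<sigma> > 0))
      = ising_E n E J (\<lambda>\<sigma>. of_bool (magnetization n \<sigma> > 0) + of_bool (- magnetization n \<sigma> > 0))"
    unfolding ising_E_add using ising_E_neg[OF G, of J "\<lambda>x. of_bool (x > 0)"] by simp
  also have "\<dots> \<le> ising_E n E J (\<lambda>_. 1)"
    by (rule ising_E_mono) (auto simp: of_bool_def)
  finally show ?thesis by simp
qed

lemma abs_magnetization_le: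
  assumes "\<sigma> \<in> spins n"
  shows "\<bar>magnetization n \<sigma>\<bar> \<le> real n"
proof -
  have "\<bar>magnetization n \<sigma>\<bar> \<le> (\<Sum>i<n. \<bar>real_of_int (\<sigma> i)\<bar>)"
    unfolding magnetization_def by (rule sum_abs)
  also have "\<dots> \<le> (\<Sum>i<n. 1)"
    using spins_cases[OF assms] by (intro sum_mono) fastforce
  finally show ?thesis by simp
qed

text \<open>The square is at most \<open>s^2\<close> in the bulk and \<open>n^2\<close> on the two
  tails, which have equal mass by symmetry. Read backwards, this bounds the tail from below.\<close>

lemma second_moment_le_tail:
  assumes G: "is_graph n E" and s: "s \<ge> 0"
  shows "ising_E n E J (\<lambda>\<sigma>. (magnetization n \<sigma>)\<^sup>2)
    \<le> s\<^sup>2 + 2 * (real n)\<^sup>2 * ising_E n E J (\<lambda>\<sigma>. of_bool (magnetization n \<sigma> > s))"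
proof -
  let ?M = "magnetization n"
  have "ising_E n E J (\<lambda>\<sigma>. (?M \<sigma>)\<^sup>2)
      \<le> ising_E n E J (\<lambda>\<sigma>. s\<^sup>2 + (real n)\<^sup>2 * (of_bool (?M \<sigma> > s) + of_bool (- ?M \<sigma> > s)))"
  proof (rule ising_E_mono)
    fix \<sigma> assume \<sigma>: "\<sigma> \<in> spins n"
    have large: "(?M \<sigma>)\<^sup>2 \<le> (real n)\<^sup>2"
      using abs_magnetization_le[OF \<sigma>] by (simp flip: abs_le_square_iff)
    have small: "(?M \<sigma>)\<^sup>2 \<le> s\<^sup>2" if "\<bar>?M \<sigma>\<bar> \<le> s"
      using that s by (simp flip: abs_le_square_iff)
    consider "\<bar>?M \<sigma>\<bar> \<le> s" | "?M \<sigma> > s" "\<not> - ?M \<sigma> > s" | "\<not> ?M \<sigma> > s" "- ?M \<sigma> > s"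
      using s by linarith
    then show "(?M \<sigma>)\<^sup>2 \<le> s\<^sup>2 + (real n)\<^sup>2 * (of_bool (?M \<sigma> > s) + of_bool (- ?M \<sigma> > s))"
    proof cases
      case 1
      then show ?thesis using small by (intro add_increasing2) auto
    qed (use large in \<open>simp_all add: add_increasing\<close>)
  qed
  also have "\<dots> = s\<^sup>2 + (real n)\<^sup>2 * (2 * ising_E n E J (\<lambda>\<sigma>. of_bool (?M \<sigma> > s)))"
    unfolding ising_E_add ising_E_cmult using ising_E_neg[OF G, of J "\<lambda>x. of_bool (x > s)"] by simp
  finally show ?thesis by (simp add: mult_ac)
qed

text \<open>By monotonicity the all-plus start is at least as likely to be magnetized at time \<open>t\<close> as a
  stationary start conditioned on magnetization above \<open>s\<close>, and the latter cannot move by \<open>s\<close>.\<close>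

lemma plus_chain_stays_magnetized:
  assumes G: "is_graph n E" and J: "\<And>e. e \<in> E \<Longrightarrow> J e \<ge> 0" and n: "n > 0" and s: "s > 0"
  shows "ising_E n E J (\<lambda>\<sigma>. of_bool (magnetization n \<sigma> > s)) *
      (1 - (glauber_op n (ising_mu n E J) ^^ t) (\<lambda>\<sigma>. of_bool (magnetization n \<sigma> > 0)) (all_plus n))
    \<le> 4 * real t / s\<^sup>2"
proof -
  let ?M = "magnetization n" and ?P = "glauber_op n (ising_mu n E J) ^^ t"
  let ?h = "\<lambda>\<sigma>. of_bool (?M \<sigma> > 0) :: real"
  have h: "mono_on (spins n) ?h"
    by (rule mono_onI) (auto simp: of_bool_def dest: less_le_trans[OF _ magnetization_mono])
  have "ising_E n E J (\<lambda>\<sigma>. of_bool (?M \<sigma> > s)) * (1 - ?P ?h (all_plus n))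
      = ising_E n E J (\<lambda>\<sigma>. (1 - ?P ?h (all_plus n)) * of_bool (?M \<sigma> > s))"
    unfolding ising_E_cmult by (rule mult.commute)
  also have "\<dots> \<le> ising_E n E J (\<lambda>\<sigma>. 1 / s\<^sup>2 * (\<Sum>y\<in>spins n. glauber_dist n E J \<sigma> t y * (?M \<sigma> - ?M y)\<^sup>2))"
  proof (rule ising_E_mono)
    fix \<sigma> assume \<sigma>: "\<sigma> \<in> spins n"
    let ?d = "glauber_dist n E J \<sigma> t"
    show "(1 - ?P ?h (all_plus n)) * of_bool (?M \<sigma> > s) \<le> 1 / s\<^sup>2 * (\<Sum>y\<in>spins n. ?d y * (?M \<sigma> - ?M y)\<^sup>2)"
    proof (cases "?M \<sigma> > s")
      case True
      have "1 - ?P ?h (all_plus n) \<le> 1 - ?P ?h \<sigma>"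
        using mono_onD[OF glauber_op_mono_on[where t = t, OF G J h] \<sigma> all_plus_in_spins le_all_plus[OF \<sigma>]] by simp
      also have "\<dots> = (\<Sum>y\<in>spins n. ?d y * (1 - ?h y))"
        unfolding glauber_dist_eq_op[OF \<sigma>, symmetric]
        by (simp add: right_diff_distrib sum_subtractf sum_glauber_dist[OF \<sigma> n])
      also have "\<dots> \<le> (\<Sum>y\<in>spins n. ?d y * (1 / s\<^sup>2 * (?M \<sigma> - ?M y)\<^sup>2))"
      proof (intro sum_mono mult_left_mono glauber_dist_nonneg)
        fix y
        \<comment> \<open>Going from above \<open>s\<close> to nonpositive magnetization is a
          displacement of at least \<open>s\<close>, so Markov's inequality applies to the squared
          displacement.\<close>
        have "s\<^sup>2 \<le> (?M \<sigma> - ?M y)\<^sup>2" if "?M y \<le> 0" using that True s by (intro power_mono) auto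
        then show "1 - ?h y \<le> 1 / s\<^sup>2 * (?M \<sigma> - ?M y)\<^sup>2"
          using s by (auto simp: of_bool_def field_simps)
      qed
      also have "\<dots> = 1 / s\<^sup>2 * (\<Sum>y\<in>spins n. ?d y * (?M \<sigma> - ?M y)\<^sup>2)"
        by (simp add: sum_distrib_left mult_ac)
      finally show ?thesis using True by simp
    next
      case False
      then show ?thesis by (auto intro!: divide_nonneg_nonneg sum_nonneg mult_nonneg_nonneg glauber_dist_nonneg)
    qed
  qed
  also have "\<dots> = displacement n E J ?M t / s\<^sup>2"
    unfolding ising_E_cmult displacement_def by simp
  also have "\<dots> \<le> 4 * real t / s\<^sup>2"
    by (intro divide_right_mono displacement_magnetization n) auto
  finally show ?thesis .
qed

section \<open>Convergence to stationarity\<close>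

lemma ising_mu_pair_le:
  assumes "\<sigma> \<in> spins n" "v < n"
  shows "ising_mu n E J (\<sigma>(v := 1)) + ising_mu n E J (\<sigma>(v := -1)) \<le> 1"
proof -
  have "\<sigma>(v := 1) \<noteq> \<sigma>(v := -1)" by (metis fun_upd_same one_neq_neg_one)
  then have "ising_mu n E J (\<sigma>(v := 1)) + ising_mu n E J (\<sigma>(v := -1))
      = (\<Sum>\<tau>\<in>{\<sigma>(v := 1), \<sigma>(v := -1)}. ising_mu n E J \<tau>)" by simp
  also have "\<dots> \<le> (\<Sum>\<tau>\<in>spins n. ising_mu n E J \<tau>)"
    using assms by (intro sum_mono2) (auto intro: ising_mu_nonneg)
  finally show ?thesis by (simp add: sum_ising_mu)
qed

text \<open>The conditional probability of \<open>s\<close> divides a stationary weight by the mass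
  of two configurations, which is at most 1.\<close>

lemma heat_bath_ge:
  assumes "\<sigma> \<in> spins n" "v < n" and f: "\<And>\<sigma>. \<sigma> \<in> spins n \<Longrightarrow> 0 \<le> f \<sigma>" and s: "s = 1 \<or> s = -1"
    and p: "\<And>\<sigma>. \<sigma> \<in> spins n \<Longrightarrow> p \<le> ising_mu n E J \<sigma>"
  shows "p * f (\<sigma>(v := s)) \<le> heat_bath (ising_mu n E J) v f \<sigma>"
proof -
  let ?W = "ising_mu n E J"
  let ?S = "?W (\<sigma>(v := 1)) + ?W (\<sigma>(v := -1))"
  let ?N = "?W (\<sigma>(v := 1)) * f (\<sigma>(v := 1)) + ?W (\<sigma>(v := -1)) * f (\<sigma>(v := -1))"
  have in_spins: "\<sigma>(v := 1) \<in> spins n" "\<sigma>(v := -1) \<in> spins n" "\<sigma>(v := s) \<in> spins n"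
    using assms(1,2) s by auto
  have S: "?S > 0" by (intro add_pos_pos ising_mu_pos)
  have N: "?N \<ge> 0" by (intro add_nonneg_nonneg mult_nonneg_nonneg ising_mu_nonneg f in_spins)
  have "p * f (\<sigma>(v := s)) \<le> ?W (\<sigma>(v := s)) * f (\<sigma>(v := s))"
    by (intro mult_right_mono p f in_spins)
  also have "\<dots> \<le> ?N"
    using s f in_spins ising_mu_nonneg[of n E J] by auto
  also have "\<dots> \<le> ?N / ?S"
    using divide_left_mono[OF ising_mu_pair_le[OF assms(1,2)] N] S by simp
  finally show ?thesis unfolding heat_bath_def .
qed

text \<open>Each update in \<open>w\<close> chooses the spin of \<open>\<tau>\<close> with
  probability at least \<open>p\<close>; if all do, the final state is the override. Nonnegativity
  is carried along because \<open>heat_bath_ge\<close> requires it of the inner function.\<close>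

lemma path_ge:
  assumes w: "set w \<subseteq> {..<n}" and f: "\<And>\<sigma>. \<sigma> \<in> spins n \<Longrightarrow> 0 \<le> f \<sigma>" and \<tau>: "\<tau> \<in> spins n"
    and p: "0 \<le> p" "\<And>\<sigma>. \<sigma> \<in> spins n \<Longrightarrow> p \<le> ising_mu n E J \<sigma>" and \<sigma>: "\<sigma> \<in> spins n"
  shows "0 \<le> foldr (heat_bath (ising_mu n E J)) w f \<sigma>"
    and "p ^ length w * f (override_on \<sigma> \<tau> (set w)) \<le> foldr (heat_bath (ising_mu n E J)) w f \<sigma>"
proof -
  let ?F = "\<lambda>w. foldr (heat_bath (ising_mu n E J)) w f"
  have "0 \<le> ?F w \<sigma> \<and> p ^ length w * f (override_on \<sigma> \<tau> (set w)) \<le> ?F w \<sigma>" if "\<sigma> \<in> spins n" for \<sigma>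
    using w that
  proof (induction w arbitrary: \<sigma>)
    case Nil
    then show ?case using f by simp
  next
    case (Cons v w)
    then have v: "v < n" and w: "set w \<subseteq> {..<n}" and \<sigma>: "\<sigma> \<in> spins n" by auto
    let ?\<sigma> = "\<sigma>(v := \<tau> v)"
    have \<sigma>': "?\<sigma> \<in> spins n" using spins_cases[OF \<tau> v] \<sigma> v by auto
    have ov: "override_on ?\<sigma> \<tau> (set w) = override_on \<sigma> \<tau> (set (v # w))"
      by (auto simp: override_on_def)
    have *: "p * ?F w ?\<sigma> \<le> heat_bath (ising_mu n E J) v (?F w) \<sigma>"
      using spins_cases[OF \<tau> v] Cons.IH[OF w] by (intro heat_bath_ge \<sigma> v p) auto
    have "p * (p ^ length w * f (override_on ?\<sigma> \<tau> (set w))) \<le> p * ?F w ?\<sigma>"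
      by (rule mult_left_mono[OF conjunct2[OF Cons.IH[OF w \<sigma>']] p(1)])
    moreover have "0 \<le> p * ?F w ?\<sigma>"
      by (rule mult_nonneg_nonneg[OF p(1) conjunct1[OF Cons.IH[OF w \<sigma>']]])
    ultimately show ?case using * ov by (simp add: mult.assoc)
  qed
  from this[OF \<sigma>] show "0 \<le> ?F w \<sigma>" "p ^ length w * f (override_on \<sigma> \<tau> (set w)) \<le> ?F w \<sigma>" by auto
qed

text \<open>The sequence \<open>[0..<n]\<close> selects every vertex once, so it can turn any
  configuration into any other. Its probability is \<open>1 / n ^ n\<close>, and the required spins
  cost another \<open>p ^ n\<close>.\<close>

lemma glauber_doeblin:
  assumes n: "n > 0"
  obtains \<delta> where "0 < \<delta>" "\<delta> \<le> 1"
    "\<And>f \<sigma> \<tau>. (\<And>\<sigma>. \<sigma> \<in> spins n \<Longrightarrow> 0 \<le> f \<sigma>) \<Longrightarrow> \<sigma> \<in> spins n \<Longrightarrow> \<tau> \<in> spins n \<Longrightarrow>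
      \<delta> * f \<tau> \<le> (glauber_op n (ising_mu n E J) ^^ n) f \<sigma>"
proof -
  define p where "p = Min (ising_mu n E J ` spins n)"
  have ne: "spins n \<noteq> {}" using all_plus_in_spins by blast
  then have "p \<in> ising_mu n E J ` spins n" unfolding p_def by (intro Min_in) auto
  then have p0: "p > 0" using ising_mu_pos by auto
  have p: "p \<le> ising_mu n E J \<sigma>" if "\<sigma> \<in> spins n" for \<sigma>
    unfolding p_def using that by (intro Min_le) auto
  define \<delta> where "\<delta> = p ^ n / real n ^ n"
  have main: "\<delta> * f \<tau> \<le> (glauber_op n (ising_mu n E J) ^^ n) f \<sigma>"
    if f: "\<And>\<sigma>. \<sigma> \<in> spins n \<Longrightarrow> 0 \<le> f \<sigma>" and \<sigma>: "\<sigma> \<in> spins n" and \<tau>: "\<tau> \<in> spins n" for f \<sigma> \<tau>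
  proof -
    let ?L = "{w. set w \<subseteq> {..<n} \<and> length w = n}" and ?F = "\<lambda>w. foldr (heat_bath (ising_mu n E J)) w f \<sigma>"
    have ov: "override_on \<sigma> \<tau> {..<n} = \<tau>"
      using spins_extensional[OF \<sigma>] spins_extensional[OF \<tau>] by (auto simp: override_on_def)
    have "p ^ n * f \<tau> \<le> ?F [0..<n]"
      using path_ge(2)[OF _ f \<tau> less_imp_le[OF p0] p \<sigma>, of "[0..<n]"] ov
      by (simp add: atLeast0LessThan)
    also have "\<dots> \<le> (\<Sum>w\<in>?L. ?F w)"
      by (intro member_le_sum path_ge(1)[OF _ f \<tau> less_imp_le[OF p0] p \<sigma>] finite_lists_length_eq) auto
    finally show ?thesis
      unfolding glauber_op_funpow_path \<delta>_def by (simp add: divide_right_mono)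
  qed
  have "\<delta> > 0" unfolding \<delta>_def using p0 n by simp
  moreover have "\<delta> \<le> 1"
    using main[of "\<lambda>_. 1" "all_plus n" "all_plus n"] n
    by (simp add: funpow_glauber_op_const ising_mu_pos)
  ultimately show ?thesis using that main by blast
qed

lemma glauber_op_affine:
  assumes "\<sigma> \<in> spins n" "n > 0"
  shows "(glauber_op n (ising_mu n E J) ^^ t) (\<lambda>\<sigma>. a * f \<sigma> + c) \<sigma>
    = a * (glauber_op n (ising_mu n E J) ^^ t) f \<sigma> + c"
proof -
  have "(\<Sum>y\<in>spins n. glauber_dist n E J \<sigma> t y * (a * f y + c))
      = a * (\<Sum>y\<in>spins n. glauber_dist n E J \<sigma> t y * f y) + c * (\<Sum>y\<in>spins n. glauber_dist n E J \<sigma> t y)"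
    by (simp add: algebra_simps sum.distrib sum_distrib_left)
  then show ?thesis
    unfolding glauber_dist_eq_op[OF assms(1)] sum_glauber_dist[OF assms] by simp
qed

text \<open>Doeblin's argument: a block of \<open>n\<close> steps shrinks the oscillation bound by
  the factor \<open>1 - \<delta>\<close>.\<close>

lemma glauber_oscillation:
  assumes n: "n > 0"
  obtains c where "0 \<le> c" "c < 1"
    "\<And>k f. (\<And>\<sigma>. \<sigma> \<in> spins n \<Longrightarrow> 0 \<le> f \<sigma> \<and> f \<sigma> \<le> 1) \<Longrightarrow>
      \<exists>m. \<forall>\<sigma>\<in>spins n. m \<le> (glauber_op n (ising_mu n E J) ^^ (n * k)) f \<sigma> \<and>
        (glauber_op n (ising_mu n E J) ^^ (n * k)) f \<sigma> \<le> m + c ^ k"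
proof -
  let ?P = "glauber_op n (ising_mu n E J)"
  obtain \<delta> where \<delta>: "0 < \<delta>" "\<delta> \<le> 1"
    "\<And>f \<sigma> \<tau>. (\<And>\<sigma>. \<sigma> \<in> spins n \<Longrightarrow> 0 \<le> f \<sigma>) \<Longrightarrow> \<sigma> \<in> spins n \<Longrightarrow> \<tau> \<in> spins n \<Longrightarrow>
      \<delta> * f \<tau> \<le> (?P ^^ n) f \<sigma>"
    using glauber_doeblin[OF n, of E J] by blast
  have "\<exists>m. \<forall>\<sigma>\<in>spins n. m \<le> (?P ^^ (n * k)) f \<sigma> \<and> (?P ^^ (n * k)) f \<sigma> \<le> m + (1 - \<delta>) ^ k"
    if f: "\<And>\<sigma>. \<sigma> \<in> spins n \<Longrightarrow> 0 \<le> f \<sigma> \<and> f \<sigma> \<le> 1" for k f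
  proof (induction k)
    case 0
    then show ?case using f by (auto intro!: exI[of _ 0])
  next
    case (Suc k)
    let ?g = "(?P ^^ (n * k)) f"
    obtain m where m: "\<And>\<sigma>. \<sigma> \<in> spins n \<Longrightarrow> m \<le> ?g \<sigma> \<and> ?g \<sigma> \<le> m + (1 - \<delta>) ^ k"
      using Suc.IH by blast
    have "Max (?g ` spins n) \<in> ?g ` spins n"
      by (intro Max_in) (simp, use all_plus_in_spins in blast)
    then obtain \<tau> where \<tau>: "\<tau> \<in> spins n" "Max (?g ` spins n) = ?g \<tau>" by auto
    have max: "?g \<sigma> \<le> ?g \<tau>" if "\<sigma> \<in> spins n" for \<sigma>
      unfolding \<tau>(2)[symmetric] using that by (intro Max_ge) auto
    have step: "(?P ^^ (n * Suc k)) f = (?P ^^ n) ?g"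
      by (simp add: funpow_add)
    show ?case
    proof (intro exI ballI conjI)
      fix \<sigma> assume \<sigma>: "\<sigma> \<in> spins n"
      \<comment> \<open>Minorizing \<open>?g - m\<close> at the maximizer \<open>\<tau>\<close>
        raises the lower bound.\<close>
      have "\<delta> * (1 * ?g \<tau> + (- m)) \<le> (?P ^^ n) (\<lambda>\<sigma>. 1 * ?g \<sigma> + (- m)) \<sigma>"
        using m by (intro \<delta>(3) \<sigma> \<tau>) auto
      then show "m + \<delta> * (?g \<tau> - m) \<le> (?P ^^ (n * Suc k)) f \<sigma>"
        unfolding step glauber_op_affine[OF \<sigma> n] by simp
      \<comment> \<open>Minorizing \<open>?g \<tau> - ?g\<close> at \<open>\<tau>\<close>, where it
        vanishes, says that the maximum does not increase.\<close>
      have "\<delta> * ((-1) * ?g \<tau> + ?g \<tau>) \<le> (?P ^^ n) (\<lambda>\<sigma>. (-1) * ?g \<sigma> + ?g \<tau>) \<sigma>"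
        using max by (intro \<delta>(3) \<sigma> \<tau>) auto
      then have "(?P ^^ n) ?g \<sigma> \<le> ?g \<tau>"
        unfolding glauber_op_affine[OF \<sigma> n] by simp
      also have "?g \<tau> = m + \<delta> * (?g \<tau> - m) + (1 - \<delta>) * (?g \<tau> - m)" by (simp add: algebra_simps)
      also have "\<dots> \<le> m + \<delta> * (?g \<tau> - m) + (1 - \<delta>) ^ Suc k"
        using m[OF \<tau>(1)] \<delta>(2) by (auto intro!: mult_left_mono)
      finally show "(?P ^^ (n * Suc k)) f \<sigma> \<le> m + \<delta> * (?g \<tau> - m) + (1 - \<delta>) ^ Suc k"
        unfolding step .
    qed
  qed
  then show ?thesis using that[of "1 - \<delta>"] \<delta>(1,2) by simp
qed

lemma glauber_mixes:
  assumes n: "n > 0" and x: "x \<in> spins n"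
  shows "\<exists>t. tv_dist (spins n) (glauber_dist n E J x t) (ising_mu n E J) \<le> 1 / 4"
proof -
  let ?P = "glauber_op n (ising_mu n E J)"
  obtain c where c: "0 \<le> c" "c < 1"
    "\<And>k f. (\<And>\<sigma>. \<sigma> \<in> spins n \<Longrightarrow> 0 \<le> f \<sigma> \<and> f \<sigma> \<le> 1) \<Longrightarrow>
      \<exists>m. \<forall>\<sigma>\<in>spins n. m \<le> (?P ^^ (n * k)) f \<sigma> \<and> (?P ^^ (n * k)) f \<sigma> \<le> m + c ^ k"
    using glauber_oscillation[OF n, of E J] by blast
  have bound: "\<bar>glauber_dist n E J x (n * k) y - ising_mu n E J y\<bar> \<le> c ^ k" if y: "y \<in> spins n" for k y
  proof -
    let ?f = "\<lambda>\<sigma>. of_bool (\<sigma> = y) :: real"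
    obtain m where m: "\<And>\<sigma>. \<sigma> \<in> spins n \<Longrightarrow> m \<le> (?P ^^ (n * k)) ?f \<sigma> \<and> (?P ^^ (n * k)) ?f \<sigma> \<le> m + c ^ k"
      using c(3)[of ?f k] by auto
    \<comment> \<open>The stationary probability of \<open>y\<close> lies in the same interval of
      length \<open>c ^ k\<close> as its probability at time \<open>n * k\<close>.\<close>
    have "m \<le> ising_E n E J ((?P ^^ (n * k)) ?f)" "ising_E n E J ((?P ^^ (n * k)) ?f) \<le> m + c ^ k"
      using ising_E_mono[of n "\<lambda>_. m" "(?P ^^ (n * k)) ?f" E J]
        ising_E_mono[of n "(?P ^^ (n * k)) ?f" "\<lambda>_. m + c ^ k" E J] m by auto
    then have "\<bar>(?P ^^ (n * k)) ?f x - ising_E n E J ?f\<bar> \<le> c ^ k"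
      using m[OF x] unfolding glauber_op_stationary[OF n] by auto
    then show ?thesis
      unfolding glauber_dist_eq_op[OF x, symmetric] ising_E_def
      using y by (simp add: of_bool_def if_distrib[of "\<lambda>z. _ * z"] cong: if_cong)
  qed
  have "(\<lambda>k. real (card (spins n)) * c ^ k) \<longlonglongrightarrow> real (card (spins n)) * 0"
    using c by (intro tendsto_intros LIMSEQ_power_zero) auto
  then have "eventually (\<lambda>k. real (card (spins n)) * c ^ k < 1 / 2) sequentially"
    by (rule order_tendstoD) simp
  then obtain k where k: "real (card (spins n)) * c ^ k < 1 / 2"
    by (auto simp: eventually_sequentially)
  have "(\<Sum>y\<in>spins n. \<bar>glauber_dist n E J x (n * k) y - ising_mu n E J y\<bar>) \<le> real (card (spins n)) * c ^ k"
    using bound by (intro sum_bounded_above)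
  then have "tv_dist (spins n) (glauber_dist n E J x (n * k)) (ising_mu n E J) \<le> 1 / 4"
    using k unfolding tv_dist_def by simp
  then show ?thesis ..
qed

section \<open>The lower bound\<close>

text \<open>With \<open>x = t / n\<close>, the power is at least
  \<open>exp (- x - 2 * x / n)\<close>. The correction \<open>ln L / (2 * L)\<close> in the time
  yields the factor \<open>sqrt L\<close>; the error \<open>2 * x / n\<close> is at most 1/2 and
  costs the factor 1/2.\<close>

lemma unvisited_mean_ge:
  fixes n t :: nat
  defines "L \<equiv> ln (real n)"
  assumes n: "n \<ge> 2" and L: "L \<ge> 1" and t: "real t \<le> (1 / 4 - ln L / (2 * L)) * real n * L"
  shows "exp (3 / 4 * L) * sqrt L / 2 \<le> real n * (1 - 1 / real n) ^ t"
proof -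
  have npos: "real n \<ge> 2" using n by simp
  define x where "x = real t / real n"
  have "x \<le> (1 / 4 - ln L / (2 * L)) * L"
    unfolding x_def using t npos by (simp add: pos_divide_le_eq mult_ac)
  also have "\<dots> = L / 4 - ln L / 2" using L by (simp add: field_simps)
  finally have x: "x \<le> L / 4 - ln L / 2" .
  have "L \<le> real n" unfolding L_def using ln_le_minus_one[of "real n"] npos by simp
  then have "2 * x \<le> real n / 2" using x ln_ge_zero[OF L] by linarith
  then have x2: "2 * x / real n \<le> 1 / 2" using npos by (simp add: field_simps)
  have "- (1 / real n) - 2 * (1 / real n)\<^sup>2 \<le> ln (1 - 1 / real n)"
    using npos by (intro ln_one_minus_pos_lower_bound) (auto simp: field_simps)
  then have "real t * (- (1 / real n) - 2 * (1 / real n)\<^sup>2) \<le> real t * ln (1 - 1 / real n)"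
    by (rule mult_left_mono) simp
  moreover have "real t * (- (1 / real n) - 2 * (1 / real n)\<^sup>2) = - x - 2 * x / real n"
    unfolding x_def by (simp add: algebra_simps power2_eq_square)
  ultimately have "- L / 4 + ln L / 2 - 1 / 2 \<le> real t * ln (1 - 1 / real n)"
    using x x2 by linarith
  then have "exp (- L / 4 + ln L / 2 - 1 / 2) \<le> exp (real t * ln (1 - 1 / real n))" by simp
  also have "exp (real t * ln (1 - 1 / real n)) = (1 - 1 / real n) ^ t"
    using npos by (simp add: exp_of_nat_mult)
  finally have "real n * exp (- L / 4 + ln L / 2 - 1 / 2) \<le> real n * (1 - 1 / real n) ^ t"
    by (rule mult_left_mono) simp
  moreover have "real n * exp (- L / 4 + ln L / 2 - 1 / 2) = exp (3 / 4 * L) * exp (ln L / 2) * exp (- 1 / 2)"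
  proof -
    have "real n = exp L" unfolding L_def using npos by simp
    then show ?thesis by (simp add: algebra_simps flip: exp_add)
  qed
  moreover have sqrt: "exp (ln L / 2) = sqrt L"
    using L by (simp flip: ln_sqrt)
  moreover have "exp (3 / 4 * L) * sqrt L * (1 / 2) \<le> exp (3 / 4 * L) * sqrt L * exp (- 1 / 2)"
    using exp_ge_add_one_self[of "- 1 / 2"] L by (intro mult_left_mono) auto
  ultimately show ?thesis unfolding sqrt by linarith
qed

text \<open>The two arguments balance at \<open>V = n powr (3/2) * ln n\<close> up to constants, where \<open>V\<close> is the
  stationary second moment of the magnetization.\<close>

lemma tmix_plus_lower_bound:
  fixes n :: nat
  defines "L \<equiv> ln (real n)"
  assumes G: "is_graph n E" and J: "\<And>e. e \<in> E \<Longrightarrow> J e \<ge> 0" and L: "L \<ge> 2 ^ 26"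
  shows "(1 / 4 - ln L / (2 * L)) * real n * L \<le> real (tmix_plus n E J)"
proof (rule ccontr)
  define t where "t = tmix_plus n E J"
  define V where "V = ising_E n E J (\<lambda>\<sigma>. (magnetization n \<sigma>)\<^sup>2)"
  \<comment> \<open>The lower bound from \<open>unvisited_mean_ge\<close> for the mean number of
    unvisited vertices.\<close>
  define m where "m = exp (3 / 4 * L) * sqrt L / 2"
  let ?P = "glauber_op n (ising_mu n E J) ^^ t" and ?M = "magnetization n"
  assume "\<not> (1 / 4 - ln L / (2 * L)) * real n * L \<le> real (tmix_plus n E J)"
  then have t: "real t \<le> (1 / 4 - ln L / (2 * L)) * real n * L" unfolding t_def by simp
  have n: "n \<ge> 2"
  proof (rule ccontr)
    assume "\<not> n \<ge> 2"
    \<comment> \<open>\<open>ln 0 = 0\<close> by convention, so \<open>L\<close> vanishes in both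
      cases.\<close>
    then have "n = 0 \<or> n = 1" by auto
    then show False using L by (auto simp: L_def)
  qed
  have nL: "real n = exp L" unfolding L_def using n by simp
  have L1: "L \<ge> 1" using L by simp
  have "tv_dist (spins n) (glauber_dist n E J (all_plus n) t) (ising_mu n E J) \<le> 1 / 4"
    unfolding t_def tmix_plus_def tmix_from_def
    by (rule LeastI_ex, rule glauber_mixes) (use n in auto)
  then have tv: "?P f (all_plus n) - ising_E n E J f \<le> 1 / 4"
    if "\<And>\<sigma>. \<sigma> \<in> spins n \<Longrightarrow> 0 \<le> f \<sigma> \<and> f \<sigma> \<le> 1" for f
    using glauber_tv_test[where f = f and E = E and J = J and t = t, OF _ all_plus_in_spins, of n] that n by fastforce
  have m4: "m ^ 4 = real n ^ 3 * L ^ 2 / 16"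
  proof -
    have "exp (3 / 4 * L) ^ 4 = real n ^ 3" unfolding nL by (simp flip: exp_of_nat_mult)
    moreover have "sqrt L ^ 4 = (sqrt L ^ 2) ^ 2" by (simp flip: power_mult)
    ultimately show ?thesis unfolding m_def using L1 by (simp add: power_divide power_mult_distrib)
  qed
  have m8: "m \<ge> 8"
  proof -
    have "sqrt L \<ge> 16" using L by (intro real_le_rsqrt) simp
    moreover have "exp (3 / 4 * L) \<ge> 1" using L1 by simp
    ultimately have "1 * 16 \<le> exp (3 / 4 * L) * sqrt L" by (intro mult_mono) auto
    then show ?thesis unfolding m_def by simp
  qed
  show False
  \<comment> \<open>At this threshold Chebyshev's inequality at level \<open>m / 4\<close> gives
    1/16. Together with \<open>4 / \<mu> \<le> 1/2\<close> the two laws are separated by at least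
    3/8, above 1/4.\<close>
  proof (cases "V \<le> (m / 4)\<^sup>2 / 16")
    case True
    define \<mu> where "\<mu> = real n * (1 - 1 / real n) ^ t"
    let ?f = "\<lambda>\<sigma>. of_bool (?M \<sigma> \<ge> m / 4) :: real"
    have \<mu>: "m \<le> \<mu>"
      unfolding m_def \<mu>_def L_def
      using unvisited_mean_ge[OF n] L1 t unfolding L_def by simp
    have "1 - 4 / \<mu> - V / (m / 4)\<^sup>2 \<le> ?P ?f (all_plus n)"
      unfolding \<mu>_def V_def
      by (rule plus_chain_lower_bound[OF G J n]) (use m8 \<mu> in \<open>auto simp: \<mu>_def\<close>)
    moreover have "ising_E n E J ?f \<le> V / (m / 4)\<^sup>2"
      unfolding V_def using m8 by (intro chebyshev) simp
    moreover have "?P ?f (all_plus n) - ising_E n E J ?f \<le> 1 / 4" by (rule tv) auto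
    moreover have "V / (m / 4)\<^sup>2 \<le> 1 / 16"
      using True m8 by (simp add: field_simps)
    moreover have "4 / \<mu> \<le> 1 / 2" using m8 \<mu> by (simp add: field_simps)
    ultimately show False by linarith
  next
    case False
    let ?h = "\<lambda>\<sigma>. of_bool (?M \<sigma> > 0) :: real"
    \<comment> \<open>This level leaves half of \<open>V\<close> to the tails, which gives
      \<open>q \<ge> V / (4 * n^2)\<close>.\<close>
    define s where "s = sqrt (V / 2)"
    define q where "q = ising_E n E J (\<lambda>\<sigma>. of_bool (?M \<sigma> > s))"
    define x where "x = 1 - ?P ?h (all_plus n)"
    have Vpos: "V > 0" using False by (smt (verit) zero_le_power2 divide_nonneg_nonneg)
    have s: "s > 0" "s\<^sup>2 = V / 2" unfolding s_def using Vpos by auto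
    have "V \<le> s\<^sup>2 + 2 * (real n)\<^sup>2 * q"
      unfolding V_def q_def using s(1) by (intro second_moment_le_tail[OF G]) simp
    then have q: "V \<le> 4 * (real n)\<^sup>2 * q" using s(2) by simp
    have qx: "q * x \<le> 4 * real t / s\<^sup>2"
      unfolding q_def x_def using n by (intro plus_chain_stays_magnetized[OF G J _ s(1)]) auto
    \<comment> \<open>From all-plus, positive magnetization has probability at most
      \<open>1/2 + 1/4\<close> at time \<open>t\<close>, so \<open>x \<ge> 1/4\<close>; the value
      1/8 leaves room for strict inequalities.\<close>
    have x: "x > 1 / 8"
      using tv[of ?h] prob_magnetization_pos_le_half[OF G, of J] unfolding x_def by fastforce
    have "(1 / 4 - ln L / (2 * L)) * (real n * L) \<le> (1 / 4) * (real n * L)"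
      using L1 ln_ge_zero[OF L1] by (intro mult_right_mono) auto
    then have t4: "real t \<le> real n * L / 4" using t by (simp add: mult.assoc)
    have "V * x \<le> 4 * (real n)\<^sup>2 * q * x" using q x by (intro mult_right_mono) auto
    also have "\<dots> = 4 * (real n)\<^sup>2 * (q * x)" by (simp add: mult_ac)
    also have "\<dots> \<le> 4 * (real n)\<^sup>2 * (8 * real t / V)"
      using qx Vpos unfolding s(2) by (intro mult_left_mono) (auto simp: field_simps)
    finally have "V\<^sup>2 * x \<le> 32 * (real n)\<^sup>2 * real t"
      using Vpos by (simp add: field_simps power2_eq_square)
    also have "\<dots> \<le> 32 * (real n)\<^sup>2 * (real n * L / 4)"
      using t4 by (intro mult_left_mono) auto
    also have "\<dots> = 8 * real n ^ 3 * L" by (simp add: power2_eq_square power3_eq_cube)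
    finally have up: "V\<^sup>2 * x \<le> 8 * real n ^ 3 * L" .
    \<comment> \<open>Conversely \<open>V\<close> exceeds \<open>m^2 / 256\<close>, and
      \<open>m ^ 4\<close> is \<open>n ^ 3 * L^2 / 16\<close>. This beats the upper bound by a
      factor of order \<open>L\<close>, and \<open>L \<ge> 2 ^ 26\<close> is what the constants
      demand.\<close>
    have "((m / 4)\<^sup>2 / 16)\<^sup>2 \<le> V\<^sup>2" using False by (intro power_mono) auto
    moreover have "((m / 4)\<^sup>2 / 16)\<^sup>2 = m ^ 4 / 2 ^ 16"
      by (simp add: power_divide flip: power_mult)
    ultimately have "real n ^ 3 * L ^ 2 / 2 ^ 20 \<le> V\<^sup>2" unfolding m4 by simp
    then have "real n ^ 3 * L ^ 2 / 2 ^ 20 * (1 / 8) < V\<^sup>2 * x"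
      using x Vpos by (intro mult_le_less_imp_less) (use n L1 in \<open>auto intro!: mult_pos_pos\<close>)
    with up have "real n ^ 3 * L * (L / 2 ^ 23) < real n ^ 3 * L * 8"
      by (simp add: power2_eq_square mult_ac)
    then have "L / 2 ^ 23 < 8"
      using n L1 by (subst (asm) mult_less_cancel_left_pos) auto
    then show False using L by simp
  qed
qed

theorem theorem1:
  shows "\<exists>\<epsilon> :: nat \<Rightarrow> real. \<epsilon> \<longlonglongrightarrow> 0 \<and>
    (\<forall>n E J. is_graph n E \<and> (\<forall>e\<in>E. J e \<ge> 0) \<longrightarrow>
       real (tmix_plus n E J) \<ge> (1/4 - \<epsilon> n) * real n * ln (real n))"
proof -
  \<comment> \<open>Below the threshold the value 1/4 makes the claimed bound 0; this also covers
    \<open>n = 0\<close>, where \<open>ln 0 = 0\<close>.\<close>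
  define \<epsilon> :: "nat \<Rightarrow> real" where
    "\<epsilon> n = (if ln (real n) \<ge> 2 ^ 26 then ln (ln (real n)) / (2 * ln (real n)) else 1 / 4)" for n
  have "(\<lambda>n. ln (ln (real n)) / (2 * ln (real n))) \<longlonglongrightarrow> 0"
    by real_asymp
  moreover have "filterlim (\<lambda>n. ln (real n)) at_top sequentially"
    by real_asymp
  then have "eventually (\<lambda>n. ln (real n) \<ge> 2 ^ 26) sequentially"
    by (simp add: filterlim_at_top)
  then have "eventually (\<lambda>n. ln (ln (real n)) / (2 * ln (real n)) = \<epsilon> n) sequentially"
    by eventually_elim (simp add: \<epsilon>_def)
  ultimately have "\<epsilon> \<longlonglongrightarrow> 0"
    by (rule Lim_transform_eventually)
  moreover have "(1/4 - \<epsilon> n) * real n * ln (real n) \<le> real (tmix_plus n E J)"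
    if "is_graph n E \<and> (\<forall>e\<in>E. J e \<ge> 0)" for n E J
    using that tmix_plus_lower_bound[of n E J] by (auto simp: \<epsilon>_def)
  ultimately show ?thesis by blast
qed

end
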